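(* Let $(X_n)_{n\in\mathbb{Z}}$ be the stationary INAR($\infty$) sequence with immigration sequence $(\varepsilon_i)_{i\in\mathbb{Z}}$ and reproduction coefficients $\alpha_k\ge0$, $k\in\mathbb{N}$, with $\sum_{k=1}^\infty\alpha_k<1$. Then $$X_n=\sum_{i\in\mathbb{Z}}\sum_{j=1}^{\varepsilon_i}F^{(i,j)}_{n-i},\qquad n\in\mathbb{Z},$$ where the processes $(F^{(i,j)}_n)_{n\in\mathbb{Z}}$ are independent (over $i\in\mathbb{Z}$ and $j\in\mathbb{N}$) copies, independent of $(\varepsilon_i)$, of the branching process $$F_n:=\sum_{g=0}^\infty G^{(g)}_n,\qquad n\in\mathbb{Z},$$ whose generations $(G_n^{(g)})_{n\in\mathbb{Z}}$, $g\in\mathbb{N}_0$, are constructed recursively by $$G^{(0)}_n:=1_{\{n=0\}},\qquad G^{(g)}_n:=\sum_{k=1}^n\sum_{m=1}^{G^{(g-1)}_{n-k}}\xi^{(n,k,g)}_m,\quad g\in\mathbb{N},\ n\in\mathbb{Z},$$ with $\xi^{(n,k,g)}_m\sim\mathrm{Pois}(\alpha_k)$ independently over $m,n,k,g$. Furthermore, the process $(F_n)$ satisfies the distributional equality $$(F_n)_{n\in\mathbb{Z}}\ \stackrel{\mathrm{d}}{=}\ \Big(1_{\{n=0\}}+\sum_{i=1}^n\sum_{j=1}^{G^{(1)}_i}F^{(i,j)}_{n-i}\Big)_{n\in\mathbb{Z}},$$ where on the right-hand side the copies $(F^{(i,j)}_n)$ are independent of $(G^{(1)}_i)_i$.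
   Context: INAR($\infty$): Given $\alpha_k\ge0$ ($k\in\mathbb{N}_0$) with $\sum_{k\ge1}\alpha_k<1$, let the immigration sequence $\varepsilon_n$, $n\in\mathbb{Z}$, be i.i.d. $\mathrm{Pois}(\alpha_0)$ and $\xi^{(n,k)}_l\sim\mathrm{Pois}(\alpha_k)$ independently over $n\in\mathbb{Z}$, $k,l\in\mathbb{N}$ and independent of $(\varepsilon_n)$. The INAR($\infty$) sequence is the almost surely unique (strictly) stationary $\mathbb{N}_0$-valued solution $(X_n)_{n\in\mathbb{Z}}$ of $X_n=\varepsilon_n+\sum_{k=1}^\infty\sum_{l=1}^{X_{n-k}}\xi^{(n,k)}_l$, $n\in\mathbb{Z}$, where $\varepsilon_n$ and $(\xi^{(n,k)}_l)_{k,l}$ are independent of $X_{n-1},X_{n-2},\dots$. Empty sums (in particular $\sum_{k=1}^n$ with $n\le0$, and $\sum_{m=1}^0$) are zero. *)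

theory Defs
  imports "HOL-Probability.Probability"
begin

text \<open>The library's \<^const>\<open>poisson_pmf\<close> is only specified for positive rates; the Poisson
  distribution with parameter 0 is the point mass at 0.\<close>

definition pois :: "real \<Rightarrow> nat pmf" where
  "pois r = (if r = 0 then return_pmf 0 else poisson_pmf r)"

abbreviation nat_space :: "nat measure" where
  "nat_space \<equiv> count_space UNIV"

text \<open>Path space of counting processes indexed by the integers, with the product sigma-algebra.
  Equality in law of two processes means equality of their image measures here.\<close>

definition path_space :: "(int \<Rightarrow> nat) measure" where
  "path_space = (\<Pi>\<^sub>M n\<in>UNIV. nat_space)"

text \<open>The library's \<^const>\<open>prob_space.indep_var\<close> requires both random variables to have the same
  value type. This is its unfolding, without that restriction.\<close>

definition indep_rv ::
  "'a measure \<Rightarrow> 'b measure \<Rightarrow> ('a \<Rightarrow> 'b) \<Rightarrow> 'c measure \<Rightarrow> ('a \<Rightarrow> 'c) \<Rightarrow> bool" where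
  "indep_rv M S X T Y \<longleftrightarrow>
     X \<in> measurable M S \<and> Y \<in> measurable M T \<and>
     prob_space.indep_set M {X -` A \<inter> space M | A. A \<in> sets S} {Y -` B \<inter> space M | B. B \<in> sets T}"

text \<open>\<open>\<epsilon> n\<close> is the immigration at time \<open>n\<close>, and \<open>\<xi> n k l\<close> (for \<open>k, l \<ge> 1\<close>) the offspring at time
  \<open>n\<close> of the \<open>l\<close>-th individual of time \<open>n - k\<close>.\<close>

definition inar_innovations ::
  "'a measure \<Rightarrow> (nat \<Rightarrow> real) \<Rightarrow> (int \<Rightarrow> 'a \<Rightarrow> nat) \<Rightarrow> (int \<Rightarrow> nat \<Rightarrow> nat \<Rightarrow> 'a \<Rightarrow> nat) \<Rightarrow> bool" where
  "inar_innovations M \<alpha> \<epsilon> \<xi> \<longleftrightarrow>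
     prob_space.indep_vars M (\<lambda>_. nat_space) \<epsilon> UNIV \<and>
     (\<forall>n. distr M nat_space (\<epsilon> n) = measure_pmf (pois (\<alpha> 0))) \<and>
     prob_space.indep_vars M (\<lambda>_. nat_space) (\<lambda>(n, k, l). \<xi> n k l) (UNIV \<times> {1..} \<times> {1..}) \<and>
     (\<forall>n. \<forall>k\<ge>1. \<forall>l\<ge>1. distr M nat_space (\<xi> n k l) = measure_pmf (pois (\<alpha> k))) \<and>
     indep_rv M path_space (\<lambda>\<omega> n. \<epsilon> n \<omega>)
       (\<Pi>\<^sub>M p\<in>UNIV \<times> {1..} \<times> {1..}. nat_space)
       (\<lambda>\<omega>. \<lambda>(n, k, l)\<in>UNIV \<times> {1..} \<times> {1..}. \<xi> n k l \<omega>)"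

text \<open>The recursion is stated in \<^typ>\<open>ennreal\<close>, where the infinite sum over the lags always has
  its proper value; in particular the sum must be almost surely finite.\<close>

definition inar_solution ::
  "'a measure \<Rightarrow> (int \<Rightarrow> 'a \<Rightarrow> nat) \<Rightarrow> (int \<Rightarrow> nat \<Rightarrow> nat \<Rightarrow> 'a \<Rightarrow> nat) \<Rightarrow> (int \<Rightarrow> 'a \<Rightarrow> nat) \<Rightarrow> bool" where
  "inar_solution M \<epsilon> \<xi> X \<longleftrightarrow>
     (\<forall>n. X n \<in> measurable M nat_space) \<and>
     (\<forall>h. distr M path_space (\<lambda>\<omega> n. X (n + h) \<omega>) = distr M path_space (\<lambda>\<omega> n. X n \<omega>)) \<and>
     (\<forall>n. AE \<omega> in M. (of_nat (X n \<omega>) :: ennreal) =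
        of_nat (\<epsilon> n \<omega>) + (\<Sum>\<^sub>\<infinity>k\<in>{1..}. of_nat (\<Sum>l=1..X (n - int k) \<omega>. \<xi> n k l \<omega>))) \<and>
     (\<forall>n. indep_rv M
        (nat_space \<Otimes>\<^sub>M (\<Pi>\<^sub>M p\<in>{1..} \<times> {1..}. nat_space))
        (\<lambda>\<omega>. (\<epsilon> n \<omega>, \<lambda>(k, l)\<in>{1..} \<times> {1..}. \<xi> n k l \<omega>))
        (\<Pi>\<^sub>M m\<in>{..<n}. nat_space) (\<lambda>\<omega>. \<lambda>m\<in>{..<n}. X m \<omega>))"

text \<open>The INAR sequence is by definition the almost surely unique stationary solution.\<close>

definition inar_sequence ::
  "'a measure \<Rightarrow> (int \<Rightarrow> 'a \<Rightarrow> nat) \<Rightarrow> (int \<Rightarrow> nat \<Rightarrow> nat \<Rightarrow> 'a \<Rightarrow> nat) \<Rightarrow> (int \<Rightarrow> 'a \<Rightarrow> nat) \<Rightarrow> bool" where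
  "inar_sequence M \<epsilon> \<xi> X \<longleftrightarrow>
     inar_solution M \<epsilon> \<xi> X \<and>
     (\<forall>Y. inar_solution M \<epsilon> \<xi> Y \<longrightarrow> (AE \<omega> in M. \<forall>n. Y n \<omega> = X n \<omega>))"

text \<open>\<open>\<zeta> n k g m\<close> (for \<open>k, g, m \<ge> 1\<close>) is the number of children born at time \<open>n\<close>, into generation
  \<open>g\<close>, to the \<open>m\<close>-th individual of generation \<open>g - 1\<close> at time \<open>n - k\<close>.\<close>

definition offspring_array ::
  "'b measure \<Rightarrow> (nat \<Rightarrow> real) \<Rightarrow> (int \<Rightarrow> nat \<Rightarrow> nat \<Rightarrow> nat \<Rightarrow> 'b \<Rightarrow> nat) \<Rightarrow> bool" where
  "offspring_array N \<alpha> \<zeta> \<longleftrightarrow>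
     prob_space.indep_vars N (\<lambda>_. nat_space) (\<lambda>(n, k, g, m). \<zeta> n k g m)
       (UNIV \<times> {1..} \<times> {1..} \<times> {1..}) \<and>
     (\<forall>n. \<forall>k\<ge>1. \<forall>g\<ge>1. \<forall>m\<ge>1. distr N nat_space (\<zeta> n k g m) = measure_pmf (pois (\<alpha> k)))"

primrec generation ::
  "(int \<Rightarrow> nat \<Rightarrow> nat \<Rightarrow> nat \<Rightarrow> 'b \<Rightarrow> nat) \<Rightarrow> nat \<Rightarrow> int \<Rightarrow> 'b \<Rightarrow> nat" where
  "generation \<zeta> 0 n \<omega> = (if n = 0 then 1 else 0)"
| "generation \<zeta> (Suc g) n \<omega> =
     (\<Sum>k=1..nat n. \<Sum>m=1..generation \<zeta> g (n - int k) \<omega>. \<zeta> n k (Suc g) m \<omega>)"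

text \<open>For every \<open>n\<close> only the generations \<open>g \<le> n\<close> contribute to the following series over \<open>g\<close>
  (see \<open>branching_eq\<close>), so it is meaningful in \<^typ>\<open>nat\<close>.\<close>

definition branching ::
  "(int \<Rightarrow> nat \<Rightarrow> nat \<Rightarrow> nat \<Rightarrow> 'b \<Rightarrow> nat) \<Rightarrow> int \<Rightarrow> 'b \<Rightarrow> nat" where
  "branching \<zeta> n \<omega> = (\<Sum>g. generation \<zeta> g n \<omega>)"

lemma generation_eq_0: "n < int g \<Longrightarrow> generation \<zeta> g n \<omega> = 0"
  by (induction g arbitrary: n) auto

lemma branching_eq: "branching \<zeta> n \<omega> = (\<Sum>g\<le>nat n. generation \<zeta> g n \<omega>)"
  unfolding branching_def by (rule suminf_finite) (auto intro!: generation_eq_0)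

text \<open>\<open>C i j\<close>, for integers \<open>i\<close> and \<open>j \<ge> 1\<close>, are independent copies of the process \<open>F\<close>.\<close>

definition indep_copies ::
  "'a measure \<Rightarrow> (int \<Rightarrow> nat \<Rightarrow> int \<Rightarrow> 'a \<Rightarrow> nat) \<Rightarrow> 'b measure \<Rightarrow> (int \<Rightarrow> 'b \<Rightarrow> nat) \<Rightarrow> bool" where
  "indep_copies M C N F \<longleftrightarrow>
     prob_space.indep_vars M (\<lambda>_. path_space) (\<lambda>(i, j) \<omega> n. C i j n \<omega>) (UNIV \<times> {1..}) \<and>
     (\<forall>i. \<forall>j\<ge>1. distr M path_space (\<lambda>\<omega> n. C i j n \<omega>) = distr N path_space (\<lambda>\<omega> n. F n \<omega>))"

text \<open>The whole family \<open>C\<close> is independent of the process \<open>Z\<close>.\<close>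

definition family_indep_of ::
  "'a measure \<Rightarrow> (int \<Rightarrow> nat \<Rightarrow> int \<Rightarrow> 'a \<Rightarrow> nat) \<Rightarrow> (int \<Rightarrow> 'a \<Rightarrow> nat) \<Rightarrow> bool" where
  "family_indep_of M C Z \<longleftrightarrow>
     indep_rv M (\<Pi>\<^sub>M p\<in>UNIV \<times> {1..}. path_space) (\<lambda>\<omega>. \<lambda>(i, j)\<in>UNIV \<times> {1..}. \<lambda>n. C i j n \<omega>)
       path_space (\<lambda>\<omega> n. Z n \<omega>)"

end

theory Submission
  imports Defs
begin

text \<open>The genealogy is read off from the INAR recursion. The individuals of time \<open>n\<close> are numbered, the
  immigrants first and then the children of the earlier individuals in lexicographic order, so that
  every immigrant has a clan of labels at each time, and the \<open>m\<close>-th member of a generation of the clan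
  has its offspring counted by the \<open>\<xi>\<close> with its label. Members that do not exist are sent to pairwise
  different labels beyond the population, where nobody else uses the \<open>\<xi>\<close>. The labels are injective and
  depend only on the past, so the relabelled variables are again independent, with the right laws, and
  independent of the immigration: the clans are independent branching processes.

  The minimal solution of the recursion has expected size at most \<open>c / (1 - a)\<close>, where \<open>a < 1\<close> is the
  total reproduction coefficient. Individuals without an immigrant ancestor have parents without one,
  hence their expected number is at most \<open>a\<close> times its own supremum over time and vanishes. The minimal
  solution is stationary, and almost sure uniqueness identifies it with \<open>X\<close>.

  The construction allows immigration that varies in time. With a single immigrant at time 0 it yields
  the branching process itself; with the children of this immigrant in the role of the immigrants it
  yields the superposition on the right-hand side of the distributional equality.\<close>

section \<open>Random injective relabellings of independent variables\<close>

text \<open>The representation is an almost sure identity, so the copies must live on the given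
  probability space and no randomness may be added. Yet a copy is required for every pair
  \<open>(i, j)\<close>, also when fewer than \<open>j\<close> immigrants arrive at time
  \<open>i\<close>, and each copy needs a full array of offspring counts, also for members that
  never exist. The \<xi> with labels beyond the population, which the recursion never consults, are
  the reserve that supplies them. The order of time makes this legitimate: the label of a parent is
  known strictly before its children are counted, so every count is fresh when it is looked up. The
  argument asks for injective labels at every sample point, so the genealogy is truncated in such a
  way that clans stay disjoint even where the recursion explodes; only the identification of clan
  sizes with generation sizes uses finiteness. The uniform bound on means serves twice: it excludes
  explosion, and it keeps the supremum in the ancestor argument finite.\<close>

abbreviation nat_prod :: "('b \<Rightarrow> nat) measure" where
  "nat_prod \<equiv> (\<Pi>\<^sub>M b\<in>UNIV. nat_space)"

abbreviation pmf_prod :: "('b \<Rightarrow> nat pmf) \<Rightarrow> ('b \<Rightarrow> nat) measure" where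
  "pmf_prod \<mu> \<equiv> (\<Pi>\<^sub>M b\<in>UNIV. measure_pmf (\<mu> b))"

lemma sets_pmf_prod [measurable_cong]: "sets (pmf_prod \<mu>) = sets nat_prod"
  by (intro sets_PiM_cong) auto

lemma space_pmf_prod [simp]: "space (pmf_prod \<mu>) = UNIV"
  by (simp add: space_PiM)

lemma prob_space_pmf_prod: "prob_space (pmf_prod \<mu>)"
  by (intro prob_space_PiM measure_pmf.prob_space_axioms)

lemma measurable_nat_prodI:
  assumes "\<And>b. (\<lambda>x. f x b) \<in> measurable M nat_space"
  shows "f \<in> measurable M nat_prod"
  using measurable_PiM_single'[of UNIV "\<lambda>b x. f x b" M "\<lambda>_. nat_space"] assms
  by (auto simp: space_PiM)

lemma measurable_from_nat_prod:
  "(\<lambda>v. v b) \<in> measurable nat_prod nat_space"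
  by simp

text \<open>Finite cylinders determine a measure on the product; every set of naturals is
  measurable, so \<open>A\<close> is arbitrary.\<close>

lemma distr_eq_pmf_prodI:
  fixes W :: "'q \<Rightarrow> 'a \<Rightarrow> nat"
  assumes "prob_space M" and W: "\<And>q. W q \<in> measurable M nat_space"
    and eq: "\<And>J A. finite J \<Longrightarrow>
      measure M {\<omega>\<in>space M. \<forall>q\<in>J. W q \<omega> \<in> A q} = (\<Prod>q\<in>J. measure (measure_pmf (\<nu> q)) (A q))"
  shows "distr M nat_prod (\<lambda>\<omega> q. W q \<omega>) = pmf_prod \<nu>"
proof -
  interpret prob_space M by fact
  interpret P: product_prob_space "\<lambda>q. measure_pmf (\<nu> q)" UNIV
    by unfold_locales
  have W': "(\<lambda>\<omega> q. W q \<omega>) \<in> measurable M nat_prod"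
    by (intro measurable_nat_prodI W)
  show ?thesis
  proof (rule P.PiM_eq)
    fix J :: "'q set" and F assume J: "finite J"
    have S: "prod_emb UNIV (\<lambda>q. measure_pmf (\<nu> q)) J (Pi\<^sub>E J F) = {v. \<forall>q\<in>J. v q \<in> F q}"
      by (auto simp: prod_emb_def PiE_iff)
    have S': "{v. \<forall>q\<in>J. v q \<in> F q} \<in> sets nat_prod"
    proof -
      have "Measurable.pred nat_prod (\<lambda>v. \<forall>q\<in>J. v q \<in> F q)"
        by (intro pred_intros_finite J) auto
      then show ?thesis by (simp add: pred_def space_PiM)
    qed
    have "emeasure (distr M nat_prod (\<lambda>\<omega> q. W q \<omega>)) {v. \<forall>q\<in>J. v q \<in> F q}
        = emeasure M {\<omega>\<in>space M. \<forall>q\<in>J. W q \<omega> \<in> F q}"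
      by (subst emeasure_distr[OF W' S']) (auto intro!: arg_cong[where f="emeasure M"])
    also have "\<dots> = (\<Prod>q\<in>J. emeasure (measure_pmf (\<nu> q)) (F q))"
      by (simp add: emeasure_eq_measure eq[OF J] measure_pmf.emeasure_eq_measure prod_ennreal)
    finally show "emeasure (distr M nat_prod (\<lambda>\<omega> q. W q \<omega>))
        (prod_emb UNIV (\<lambda>q. measure_pmf (\<nu> q)) J (Pi\<^sub>E J F))
        = (\<Prod>q\<in>J. emeasure (measure_pmf (\<nu> q)) (F q))"
      by (simp only: S)
  qed (simp add: sets_pmf_prod)
qed

text \<open>Invariance under changing coordinate \<open>b\<close> replaces measurability with
  respect to the other coordinates: Fubini splits off that coordinate, and the rest of the event is
  evaluated with 0 in its place.\<close>

lemma prob_coordinate_indep: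
  assumes E: "Measurable.pred nat_prod E" and inv: "\<And>v y. E (v(b := y)) \<longleftrightarrow> E v"
  shows "measure (pmf_prod \<mu>) {v. E v \<and> v b \<in> A}
       = measure (pmf_prod \<mu>) {v. E v} * measure (measure_pmf (\<mu> b)) A"
proof -
  interpret prob_space "pmf_prod \<mu>" by (rule prob_space_pmf_prod)
  have [measurable]: "Measurable.pred nat_prod E" by fact
  let ?N = "\<Pi>\<^sub>M i\<in>UNIV - {b}. measure_pmf (\<mu> i)"
  let ?Q = "measure_pmf (\<mu> b) \<Otimes>\<^sub>M ?N"
  let ?f = "\<lambda>(x, X). X(b := x) :: _ \<Rightarrow> nat"
  interpret N: prob_space ?N by (intro prob_space_PiM measure_pmf.prob_space_axioms)
  interpret Q: pair_prob_space "measure_pmf (\<mu> b)" ?N ..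
  have "distr ?Q (\<Pi>\<^sub>M i\<in>insert b (UNIV - {b}). measure_pmf (\<mu> i)) ?f
      = (\<Pi>\<^sub>M i\<in>insert b (UNIV - {b}). measure_pmf (\<mu> i))"
    by (rule distr_pair_PiM_eq_PiM) (auto intro: measure_pmf.prob_space_axioms)
  moreover have "insert b (UNIV - {b}) = UNIV" by auto
  ultimately have D: "distr ?Q (pmf_prod \<mu>) ?f = pmf_prod \<mu>" by simp
  have f: "?f \<in> measurable ?Q (pmf_prod \<mu>)"
    unfolding split_beta by (rule measurable_fun_upd[where J="UNIV - {b}"]) auto
  have *: "emeasure (pmf_prod \<mu>) {v. E v \<and> v b \<in> B}
      = emeasure (measure_pmf (\<mu> b)) B * emeasure ?N {X\<in>space ?N. E (X(b := 0))}" for B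
  proof -
    have m: "{v. E v \<and> v b \<in> B} \<in> sets (pmf_prod \<mu>)"
    proof -
      have "Measurable.pred nat_prod (\<lambda>v. E v \<and> v b \<in> B)" by measurable
      then show ?thesis by (simp add: pred_def space_PiM sets_pmf_prod)
    qed
    have "emeasure (pmf_prod \<mu>) {v. E v \<and> v b \<in> B}
        = emeasure ?Q (?f -` {v. E v \<and> v b \<in> B} \<inter> space ?Q)"
      using emeasure_distr[OF f m] D by simp
    also have "?f -` {v. E v \<and> v b \<in> B} \<inter> space ?Q
        = B \<times> {X\<in>space ?N. E (X(b := 0))}"
    proof -
      have "E (X(b := x)) = E (X(b := 0))" for x X
        using inv[of "X(b := x)" 0] by simp
      then show ?thesis by (auto simp: space_pair_measure)
    qed
    also have "emeasure ?Q \<dots>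
        = emeasure (measure_pmf (\<mu> b)) B * emeasure ?N {X\<in>space ?N. E (X(b := 0))}"
    proof (rule N.emeasure_pair_measure_Times)
      have 1: "(\<lambda>X. X(b := 0)) \<in> measurable ?N (pmf_prod \<mu>)"
        by (rule measurable_fun_upd[where J="UNIV - {b}"]) auto
      have 2: "Measurable.pred (pmf_prod \<mu>) E"
        using E by (simp add: pred_def sets_pmf_prod space_PiM)
      have "Measurable.pred ?N (\<lambda>X. E (X(b := 0)))"
        using measurable_compose[OF 1 2] .
      then show "{X\<in>space ?N. E (X(b := 0))} \<in> sets ?N"
        by (simp add: pred_def)
    qed auto
    finally show ?thesis .
  qed
  have "emeasure (pmf_prod \<mu>) {v. E v} = emeasure ?N {X\<in>space ?N. E (X(b := 0))}"
    using *[of UNIV] measure_pmf.emeasure_space_1[of "\<mu> b"] by simp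
  with *[of A] have "emeasure (pmf_prod \<mu>) {v. E v \<and> v b \<in> A}
      = emeasure (measure_pmf (\<mu> b)) A * emeasure (pmf_prod \<mu>) {v. E v}" by simp
  then show ?thesis
    by (simp add: emeasure_eq_measure measure_pmf.emeasure_eq_measure mult.commute
        flip: ennreal_mult)
qed

text \<open>The index looked up for \<open>q\<close> is chosen by looking only at rows before row \<open>\<rho> q\<close>, and no index
  is ever used twice: the value found there is always fresh.\<close>

theorem distr_relabel:
  fixes sel :: "'q \<Rightarrow> ('b::countable \<Rightarrow> nat) \<Rightarrow> 'b" and row :: "'b \<Rightarrow> 'r::linorder"
  assumes meas: "\<And>q. sel q \<in> measurable nat_prod (count_space UNIV)"
    and row: "\<And>q v. row (sel q v) = \<rho> q"
    and past: "\<And>q v v'. (\<And>b. row b < \<rho> q \<Longrightarrow> v b = v' b) \<Longrightarrow> sel q v = sel q v'"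
    and inj: "\<And>v. inj (\<lambda>q. sel q v)"
    and law: "\<And>q v. \<mu> (sel q v) = \<nu> q"
  shows "(\<lambda>v q. v (sel q v)) \<in> measurable nat_prod nat_prod"
    and "distr (pmf_prod \<mu>) nat_prod (\<lambda>v q. v (sel q v)) = pmf_prod \<nu>"
proof -
  interpret prob_space "pmf_prod \<mu>" by (rule prob_space_pmf_prod)
  note [measurable] = meas
  have W: "(\<lambda>v. v (sel q v)) \<in> measurable nat_prod nat_space" for q
    by (rule measurable_compose_countable[OF _ meas]) simp
  then show "(\<lambda>v q. v (sel q v)) \<in> measurable nat_prod nat_prod"
    by (intro measurable_nat_prodI)
  have cyl: "Measurable.pred nat_prod (\<lambda>v. \<forall>q\<in>J. v (sel q v) \<in> A q)" if "finite J" for J A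
  proof (intro pred_intros_finite that)
    fix q
    show "Measurable.pred nat_prod (\<lambda>v. v (sel q v) \<in> A q)"
      using measurable_compose[OF W, of "\<lambda>x. x \<in> A q" "count_space UNIV" q] by simp
  qed
  have prod: "prob {v. \<forall>q\<in>J. v (sel q v) \<in> A q} = (\<Prod>q\<in>J. measure (measure_pmf (\<nu> q)) (A q))"
    if "finite J" for J A
    using that
  proof (induction "card J" arbitrary: J)
    case 0
    then show ?case using prob_space by simp
  next
    case (Suc n)
    then have ne: "\<rho> ` J \<noteq> {}" "finite (\<rho> ` J)" by auto
    \<comment> \<open>An index of latest row is removed, so that every index of \<open>J\<close> is
      selected without looking at rows from \<open>\<rho> q\<close> on.\<close>
    obtain q where q: "q \<in> J" "\<rho> q = Max (\<rho> ` J)"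
      using Max_in[OF ne(2,1)] by auto
    define J' where "J' = J - {q}"
    have J': "finite J'" "J = insert q J'" "q \<notin> J'" "n = card J'"
      using Suc q by (auto simp: J'_def)
    have le: "\<rho> p \<le> \<rho> q" if "p \<in> J'" for p
      using that J'(2) ne(2) unfolding q(2) by (intro Max_ge) auto
    define E where "E v \<longleftrightarrow> (\<forall>p\<in>J'. v (sel p v) \<in> A p)" for v
    have E [measurable]: "Measurable.pred nat_prod E"
      unfolding E_def using cyl[OF J'(1)] .
    \<comment> \<open>Fixing the value \<open>b\<close> of \<open>sel q v\<close> makes the lookup
      deterministic. Changing \<open>v b\<close> alters no selection, since \<open>b\<close> lies in
      row \<open>\<rho> q\<close>, and where \<open>sel q v = b\<close> injectivity keeps the other
      lookups away from \<open>b\<close>. Hence \<open>E v \<and> sel q v = b\<close> is independent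
      of \<open>v b\<close>.\<close>
    have step: "prob {v. (E v \<and> sel q v = b) \<and> v b \<in> A q}
        = prob {v. E v \<and> sel q v = b} * measure (measure_pmf (\<nu> q)) (A q)" for b
    proof (cases "\<exists>v. sel q v = b")
      case False
      then show ?thesis by simp
    next
      case True
      then have b: "row b = \<rho> q" "\<mu> b = \<nu> q" using row law by auto
      have lam: "sel p (v(b := y)) = sel p v" if "\<rho> p \<le> \<rho> q" for p v y
        by (rule past) (use that b in auto)
      have "(E (v(b := y)) \<and> sel q (v(b := y)) = b) \<longleftrightarrow> (E v \<and> sel q v = b)" for v y
      proof (cases "sel q v = b")
        case True
        then have "sel p v \<noteq> b" if "p \<in> J'" for p
          using injD[OF inj, of p v q] that J'(3) by metis
        then show ?thesis using le by (auto simp: E_def lam)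
      qed (simp add: lam)
      then show ?thesis
        unfolding b(2)[symmetric] by (intro prob_coordinate_indep) auto
    qed
    have ev: "{v. P v} \<in> events" if "Measurable.pred nat_prod P" for P
      using that by (simp add: pred_def sets_pmf_prod space_PiM)
    have tot: "ennreal (prob {v. P v}) =
        (\<integral>\<^sup>+b. ennreal (prob {v. P v \<and> sel q v = b}) \<partial>count_space UNIV)"
      if P [measurable]: "Measurable.pred nat_prod P" for P
    proof -
      have "emeasure (pmf_prod \<mu>) (\<Union>b. {v. P v \<and> sel q v = b})
          = (\<integral>\<^sup>+b. emeasure (pmf_prod \<mu>) {v. P v \<and> sel q v = b} \<partial>count_space UNIV)"
        by (intro emeasure_UN_countable ev) (auto simp: disjoint_family_on_def)
      moreover have "(\<Union>b. {v. P v \<and> sel q v = b}) = {v. P v}" by auto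
      ultimately show ?thesis by (simp add: emeasure_eq_measure)
    qed
    have "ennreal (prob {v. \<forall>p\<in>J. v (sel p v) \<in> A p})
        = (\<integral>\<^sup>+b. ennreal (prob {v. (\<forall>p\<in>J. v (sel p v) \<in> A p) \<and> sel q v = b}) \<partial>count_space UNIV)"
      by (rule tot[OF cyl[OF Suc.prems]])
    also have "\<dots> = (\<integral>\<^sup>+b. ennreal (prob {v. (E v \<and> sel q v = b) \<and> v b \<in> A q}) \<partial>count_space UNIV)"
      unfolding J'(2) E_def
      by (intro nn_integral_cong arg_cong[where f=ennreal] arg_cong[where f=prob]) auto
    also have "\<dots> = (\<integral>\<^sup>+b. ennreal (prob {v. E v \<and> sel q v = b}) * ennreal (measure (measure_pmf (\<nu> q)) (A q)) \<partial>count_space UNIV)"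
      by (simp only: step ennreal_mult measure_nonneg)
    also have "\<dots> = ennreal (prob {v. E v}) * ennreal (measure (measure_pmf (\<nu> q)) (A q))"
      by (simp add: nn_integral_multc tot[OF E])
    finally have "prob {v. \<forall>p\<in>J. v (sel p v) \<in> A p} = prob {v. E v} * measure (measure_pmf (\<nu> q)) (A q)"
      by (simp flip: ennreal_mult)
    then show ?case
      using Suc.hyps(1)[OF J'(4,1)] J' by (simp add: E_def mult.commute)
  qed
  show "distr (pmf_prod \<mu>) nat_prod (\<lambda>v q. v (sel q v)) = pmf_prod \<nu>"
  proof (rule distr_eq_pmf_prodI)
    show "(\<lambda>v. v (sel q v)) \<in> measurable (pmf_prod \<mu>) nat_space" for q
      using W by simp
  qed (use prod prob_space_axioms in simp_all)
qed

section \<open>The minimal solution of the recursion\<close>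

type_synonym inar_data = "(int + int \<times> nat \<times> nat) \<Rightarrow> nat"

abbreviation immi :: "inar_data \<Rightarrow> int \<Rightarrow> nat" where
  "immi v n \<equiv> v (Inl n)"

text \<open>All indices start at 0: \<open>kids v n k l\<close> plays the role of \<open>\<xi> n (Suc k) (Suc l)\<close>.\<close>

abbreviation kids :: "inar_data \<Rightarrow> int \<Rightarrow> nat \<Rightarrow> nat \<Rightarrow> nat" where
  "kids v n k l \<equiv> v (Inr (n, k, l))"

text \<open>Rounds of the recursion started from the empty process. Values in \<open>ennreal\<close>
  admit divergent sums over the lags; the inner sum runs over all \<open>l\<close> with a strict
  cutoff, so it also makes sense for an infinite population.\<close>

primrec approx :: "nat \<Rightarrow> inar_data \<Rightarrow> int \<Rightarrow> ennreal" where
  "approx 0 v n = 0"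
| "approx (Suc r) v n = of_nat (immi v n) +
     (\<Sum>k. \<Sum>l. if of_nat l < approx r v (n - 1 - int k) then of_nat (kids v n k l) else 0)"

definition tot :: "inar_data \<Rightarrow> int \<Rightarrow> ennreal" where
  "tot v n = (SUP r. approx r v n)"

text \<open>An infinite total gives 0, so \<open>pop\<close> is defined for every \<open>v\<close>;
  a finite total is an integer and the floor loses nothing (\<open>tot_eq_pop\<close>).\<close>

definition pop :: "inar_data \<Rightarrow> int \<Rightarrow> nat" where
  "pop v n = nat \<lfloor>enn2real (tot v n)\<rfloor>"

definition regular :: "inar_data \<Rightarrow> bool" where
  "regular v \<longleftrightarrow> (\<forall>n. tot v n \<noteq> \<top>)"

lemma approx_Suc_mono: "approx r v n \<le> approx (Suc r) v n"
proof (induction r arbitrary: n)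
  case (Suc r)
  have "(if of_nat l < approx r v m then of_nat (kids v n k l) else 0)
      \<le> ((if of_nat l < approx (Suc r) v m then of_nat (kids v n k l) else 0) :: ennreal)" for m k l
    using Suc.IH[of m] by (auto dest: less_le_trans simp del: approx.simps)
  then show ?case
    unfolding approx.simps(2)[of "Suc r"]
    by (subst approx.simps(2)[of r]) (intro add_left_mono suminf_le summableI)
qed simp

lemma incseq_approx: "incseq (\<lambda>r. approx r v n)"
  by (intro incseq_SucI approx_Suc_mono)

lemma tot_eq_SUP_Suc: "tot v n = (SUP r. approx (Suc r) v n)"
  unfolding tot_def
  by (rule antisym) (auto intro!: SUP_mono simp del: approx.simps intro: approx_Suc_mono)

lemma tot_eq: "tot v n = of_nat (immi v n) +
    (\<Sum>k. \<Sum>l. if of_nat l < tot v (n - 1 - int k) then of_nat (kids v n k l) else 0)"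
proof -
  define f where "f r k l =
    (if of_nat l < approx r v (n - 1 - int k) then of_nat (kids v n k l) else 0 :: ennreal)" for r k l
  have inc: "incseq (\<lambda>r. f r k l)" for k l
    using incseq_approx[of v "n - 1 - int k"]
    by (auto simp: f_def incseq_def intro: less_le_trans)
  have inc': "incseq (\<lambda>r. \<Sum>l. f r k l)" for k
    using inc by (auto simp: incseq_def intro!: suminf_le)
  \<comment> \<open>The cutoff is strict, so an \<open>l\<close> below the supremum is already below
    the value of some round.\<close>
  have lim: "(SUP r. f r k l) =
      (if of_nat l < tot v (n - 1 - int k) then of_nat (kids v n k l) else 0)" for k l
  proof (cases "of_nat l < tot v (n - 1 - int k)")
    case True
    then obtain r where "of_nat l < approx r v (n - 1 - int k)"
      by (auto simp: tot_def less_SUP_iff)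
    then have "of_nat (kids v n k l) \<le> (SUP r. f r k l)"
      by (intro SUP_upper2[of r]) (auto simp: f_def)
    moreover have "(SUP r. f r k l) \<le> of_nat (kids v n k l)"
      by (intro SUP_least) (auto simp: f_def)
    ultimately show ?thesis using True by simp
  next
    case False
    then have "f r k l = 0" for r
      by (auto simp: f_def tot_def less_SUP_iff)
    then show ?thesis using False by simp
  qed
  have "tot v n = (SUP r. approx (Suc r) v n)"
    by (rule tot_eq_SUP_Suc)
  also have "\<dots> = (SUP r. of_nat (immi v n) + (\<Sum>k. \<Sum>l. f r k l))"
    by (simp add: f_def)
  also have "\<dots> = of_nat (immi v n) + (SUP r. \<Sum>k. \<Sum>l. f r k l)"
    by (simp add: ennreal_SUP_add_right)
  also have "(SUP r. \<Sum>k. \<Sum>l. f r k l) = (\<Sum>k. \<Sum>l. SUP r. f r k l)"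
    using inc inc' by (simp add: ennreal_suminf_SUP_eq)
  also have "of_nat (immi v n) + \<dots> = of_nat (immi v n) +
    (\<Sum>k. \<Sum>l. if of_nat l < tot v (n - 1 - int k) then of_nat (kids v n k l) else 0)"
    by (simp only: lim)
  finally show ?thesis .
qed

section \<open>Integrality of the minimal solution\<close>

definition ext_nat :: "ennreal \<Rightarrow> bool" where
  "ext_nat z \<longleftrightarrow> z = \<top> \<or> (\<exists>m. z = of_nat m)"

lemma ext_nat_of_nat [simp]: "ext_nat (of_nat m)"
  by (auto simp: ext_nat_def)

lemma ext_nat_0 [simp]: "ext_nat 0"
  using ext_nat_of_nat[of 0] by simp

lemma ext_nat_add: "ext_nat x \<Longrightarrow> ext_nat y \<Longrightarrow> ext_nat (x + y)"
  unfolding ext_nat_def by (auto intro: of_nat_add[symmetric])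

text \<open>Integer terms that tend to 0 are eventually 0.\<close>

lemma suminf_of_nat_finite_support:
  assumes "(\<Sum>k. of_nat (f k) :: ennreal) \<noteq> \<top>"
  shows "finite {k. f k \<noteq> 0}"
proof -
  have "(\<Sum>k. ennreal (real (f k))) \<noteq> \<top>"
    using assms by (simp add: ennreal_of_nat_eq_real_of_nat)
  then have "summable (\<lambda>k. real (f k))"
    by (rule summable_suminf_not_top[rotated]) simp
  then have "(\<lambda>k. real (f k)) \<longlonglongrightarrow> 0"
    by (rule summable_LIMSEQ_zero)
  then have "eventually (\<lambda>k. real (f k) < 1) sequentially"
    by (rule order_tendstoD) simp
  then obtain N where "\<And>k. k \<ge> N \<Longrightarrow> real (f k) < 1"
    by (auto simp: eventually_sequentially)
  then have "k < N" if "f k \<noteq> 0" for k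
    using that by (metis gr0I less_one linorder_not_less of_nat_less_1_iff)
  then have "{k. f k \<noteq> 0} \<subseteq> {..<N}"
    by blast
  then show ?thesis by (rule finite_subset) simp
qed

lemma suminf_of_nat_eq:
  assumes "finite {k. f k \<noteq> 0}"
  shows "(\<Sum>k. of_nat (f k) :: ennreal) = of_nat (\<Sum>k\<in>{k. f k \<noteq> 0}. f k)"
  using suminf_finite[OF assms, of "\<lambda>k. of_nat (f k) :: ennreal"] by simp

lemma ext_nat_suminf:
  assumes "\<And>k. ext_nat (f k)"
  shows "ext_nat (\<Sum>k. f k)"
proof (cases "(\<Sum>k. f k) = \<top>")
  case False
  have "f k \<noteq> \<top>" for k
    using False sum_le_suminf[of f "{k}"] by (auto simp: top_unique)
  then obtain g where g: "\<And>k. f k = of_nat (g k)"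
    using assms unfolding ext_nat_def by metis
  have ne: "(\<Sum>k. of_nat (g k)) \<noteq> (\<top> :: ennreal)"
    using False unfolding g .
  show ?thesis
    unfolding g suminf_of_nat_eq[OF suminf_of_nat_finite_support[OF ne]] by (rule ext_nat_of_nat)
qed (simp add: ext_nat_def)

lemma ext_nat_approx: "ext_nat (approx r v n)"
  by (cases r) (auto intro!: ext_nat_add ext_nat_suminf)

lemma ext_nat_tot: "ext_nat (tot v n)"
  by (subst tot_eq) (auto intro!: ext_nat_add ext_nat_suminf)

lemma tot_eq_pop: "tot v n \<noteq> \<top> \<Longrightarrow> tot v n = of_nat (pop v n)"
  using ext_nat_tot[of v n] by (auto simp: ext_nat_def pop_def)

lemma regular_tot: "regular v \<Longrightarrow> tot v n = of_nat (pop v n)"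
  by (simp add: tot_eq_pop regular_def)

lemma pop_eq:
  assumes "regular v"
  shows "(of_nat (pop v n) :: ennreal) = of_nat (immi v n) +
    (\<Sum>k. of_nat (\<Sum>l<pop v (n - 1 - int k). kids v n k l))"
proof -
  have "(\<Sum>l. if of_nat l < (of_nat m :: ennreal) then of_nat (kids v n k l) else 0)
      = (of_nat (\<Sum>l<m. kids v n k l) :: ennreal)" for m k
    using suminf_finite[of "{..<m}" "\<lambda>l. if l < m then of_nat (kids v n k l) else 0 :: ennreal"]
    by simp
  then show ?thesis
    using tot_eq[of v n] by (simp add: regular_tot[OF assms])
qed

text \<open>Integrality is essential: for \<open>z = 1/2\<close> the left-hand side is 1.\<close>

lemma count_below_le:
  assumes "ext_nat z"
  shows "(\<Sum>l. if of_nat l < z then 1 else 0) \<le> z"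
proof (cases "z = \<top>")
  case False
  then obtain m where z: "z = of_nat m" using assms by (auto simp: ext_nat_def)
  have "(\<Sum>l. if l < m then 1 else 0) = (\<Sum>l<m. if l < m then 1 else 0 :: ennreal)"
    by (rule suminf_finite) auto
  also have "\<dots> = z" by (simp add: z)
  finally show ?thesis by (simp add: z)
qed simp

section \<open>Causality and measurability of the minimal solution\<close>

definition time :: "int + int \<times> nat \<times> nat \<Rightarrow> int" where
  "time b = (case b of Inl n \<Rightarrow> n | Inr (n, k, l) \<Rightarrow> n)"

lemma time_simps [simp]: "time (Inl n) = n" "time (Inr (n, k, l)) = n"
  by (simp_all add: time_def)

text \<open>Expresses dependence on the data up to time \<open>t\<close>. The bound is inclusive
  because the immigrants and the children born at \<open>t\<close> enter the population at
  \<open>t\<close>.\<close>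

definition agree :: "int \<Rightarrow> inar_data \<Rightarrow> inar_data \<Rightarrow> bool" where
  "agree t v v' \<longleftrightarrow> (\<forall>b. time b \<le> t \<longrightarrow> v b = v' b)"

lemma agree_mono: "agree t v v' \<Longrightarrow> s \<le> t \<Longrightarrow> agree s v v'"
  by (auto simp: agree_def)

lemma agree_upd: "t < time b \<Longrightarrow> agree t (v(b := y)) v"
  by (auto simp: agree_def)

lemma agreeD: "agree t v v' \<Longrightarrow> time b \<le> t \<Longrightarrow> v b = v' b"
  by (auto simp: agree_def)

lemma approx_cong: "agree n v v' \<Longrightarrow> approx r v n = approx r v' n"
proof (induction r arbitrary: n)
  case (Suc r)
  have "approx r v (n - 1 - int k) = approx r v' (n - 1 - int k)" for k
    by (rule Suc.IH[OF agree_mono[OF Suc.prems]]) simp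
  moreover have "immi v n = immi v' n" "kids v n k l = kids v' n k l" for k l
    using agreeD[OF Suc.prems] by simp_all
  ultimately show ?case by (simp only: approx.simps)
qed simp

lemma tot_cong: "agree n v v' \<Longrightarrow> tot v n = tot v' n"
  by (simp add: tot_def approx_cong)

lemma pop_cong: "agree n v v' \<Longrightarrow> pop v n = pop v' n"
  by (simp add: pop_def tot_cong)

lemma measurable_approx [measurable]: "(\<lambda>v. approx r v n) \<in> borel_measurable nat_prod"
proof (induction r arbitrary: n)
  case (Suc r)
  note [measurable] = Suc.IH
  show ?case unfolding approx.simps by measurable
qed simp

lemma measurable_tot [measurable]: "(\<lambda>v. tot v n) \<in> borel_measurable nat_prod"
  unfolding tot_def by measurable

lemma measurable_pop [measurable]: "(\<lambda>v. pop v n) \<in> measurable nat_prod nat_space"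
  unfolding pop_def by measurable

section \<open>First-moment bounds\<close>

lemma sets_Collect_pmf_prod:
  "Measurable.pred nat_prod P \<Longrightarrow> {v. P v} \<in> sets (pmf_prod \<mu>)"
  by (simp add: pred_def sets_pmf_prod space_PiM)

text \<open>The expectation is the sum over \<open>i\<close> of the probabilities of
  \<open>v b > i\<close>, and \<open>prob_coordinate_indep\<close> applies to each of them.\<close>

lemma nn_integral_coordinate_indep:
  assumes E: "Measurable.pred nat_prod E" and inv: "\<And>v y. E (v(b := y)) \<longleftrightarrow> E v"
  shows "(\<integral>\<^sup>+v. (if E v then of_nat (v b) else 0) \<partial>pmf_prod \<mu>)
       = emeasure (pmf_prod \<mu>) {v. E v} * (\<integral>\<^sup>+x. of_nat x \<partial>measure_pmf (\<mu> b))"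
proof -
  interpret prob_space "pmf_prod \<mu>" by (rule prob_space_pmf_prod)
  note [measurable] = E
  have P: "Measurable.pred nat_prod (\<lambda>v. E v \<and> v b \<in> A)" for A
    using measurable_compose[OF measurable_from_nat_prod, of "\<lambda>x. x \<in> A" "count_space UNIV" b]
    by simp
  have cnt: "(of_nat x :: ennreal) = (\<Sum>i. indicator {i<..} x)" for x :: nat
  proof -
    have "(\<Sum>i. indicator {i<..} x) = (\<Sum>i<x. indicator {i<..} x :: ennreal)"
      by (rule suminf_finite) auto
    also have "\<dots> = of_nat x" by simp
    finally show ?thesis by simp
  qed
  have "(if E v then of_nat (v b) else 0) = (\<Sum>i. indicator {v. E v \<and> v b \<in> {i<..}} v :: ennreal)" for v
    by (cases "E v") (simp_all add: cnt indicator_def)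
  then have "(\<integral>\<^sup>+v. (if E v then of_nat (v b) else 0) \<partial>pmf_prod \<mu>)
      = (\<Sum>i. \<integral>\<^sup>+v. indicator {v. E v \<and> v b \<in> {i<..}} v \<partial>pmf_prod \<mu>)"
    by (simp only:) (intro nn_integral_suminf borel_measurable_indicator sets_Collect_pmf_prod P)
  also have "\<dots> = (\<Sum>i. emeasure (pmf_prod \<mu>) {v. E v \<and> v b \<in> {i<..}})"
    by (intro suminf_cong nn_integral_indicator sets_Collect_pmf_prod P)
  also have "\<dots> = (\<Sum>i. emeasure (pmf_prod \<mu>) {v. E v} * emeasure (measure_pmf (\<mu> b)) {i<..})"
    unfolding emeasure_eq_measure measure_pmf.emeasure_eq_measure
      prob_coordinate_indep[OF E inv] by (simp add: ennreal_mult)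
  also have "\<dots> = emeasure (pmf_prod \<mu>) {v. E v} * (\<Sum>i. emeasure (measure_pmf (\<mu> b)) {i<..})"
    by (rule ennreal_suminf_cmult)
  also have "(\<Sum>i. emeasure (measure_pmf (\<mu> b)) {i<..}) = (\<integral>\<^sup>+x. of_nat x \<partial>measure_pmf (\<mu> b))"
    unfolding cnt by (subst nn_integral_suminf) auto
  finally show ?thesis .
qed

lemma nn_integral_pois:
  assumes "0 \<le> r"
  shows "(\<integral>\<^sup>+x. of_nat x \<partial>measure_pmf (pois r)) = ennreal r"
proof (cases "r = 0")
  case False
  with assms have r: "0 < r" by simp
  have "(\<lambda>k. r ^ k /\<^sub>R fact k) sums exp r"
    by (rule exp_converges)
  then have "(\<lambda>k. r * exp (- r) * (r ^ k /\<^sub>R fact k)) sums (r * exp (- r) * exp r)"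
    by (rule sums_mult)
  moreover have "r * exp (- r) * (r ^ k /\<^sub>R fact k)
      = (r ^ Suc k / fact (Suc k) * exp (- r)) * real (Suc k)" for k
    by (simp add: field_simps del: of_nat_Suc)
  moreover have "r * exp (- r) * exp r = r" by (simp add: exp_minus)
  ultimately have "(\<lambda>k. (r ^ Suc k / fact (Suc k) * exp (- r)) * real (Suc k)) sums r"
    by simp
  then have s: "(\<lambda>k. (r ^ k / fact k * exp (- r)) * real k) sums r"
    by (subst (asm) sums_Suc_iff) simp
  have "(\<integral>\<^sup>+x. of_nat x \<partial>measure_pmf (pois r))
      = (\<integral>\<^sup>+x. ennreal (pmf (poisson_pmf r) x) * of_nat x \<partial>count_space UNIV)"
    using False by (simp add: pois_def nn_integral_measure_pmf)
  also have "\<dots> = (\<Sum>k. ennreal ((r ^ k / fact k * exp (- r)) * real k))"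
    using r by (simp add: nn_integral_count_space_nat ennreal_of_nat_eq_real_of_nat flip: ennreal_mult)
  also have "\<dots> = ennreal r"
    using s r by (intro suminf_ennreal_eq) auto
  finally show ?thesis .
qed (simp add: pois_def)

definition data_law :: "(int \<Rightarrow> nat pmf) \<Rightarrow> (nat \<Rightarrow> real) \<Rightarrow> int + int \<times> nat \<times> nat \<Rightarrow> nat pmf" where
  "data_law \<mu> \<beta> b = (case b of Inl n \<Rightarrow> \<mu> n | Inr (n, k, l) \<Rightarrow> pois (\<beta> k))"

lemma data_law_simps [simp]:
  "data_law \<mu> \<beta> (Inl n) = \<mu> n" "data_law \<mu> \<beta> (Inr (n, k, l)) = pois (\<beta> k)"
  by (simp_all add: data_law_def)

text \<open>\<open>\<beta> k\<close> stands for the reproduction coefficient at lag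
  \<open>Suc k\<close>.\<close>

locale subcritical =
  fixes \<beta> :: "nat \<Rightarrow> real"
  assumes beta_nonneg: "0 \<le> \<beta> k"
    and beta_summable: "summable \<beta>"
    and beta_less_1: "(\<Sum>k. \<beta> k) < 1"
begin

lemma suminf_beta: "(\<Sum>k. ennreal (\<beta> k)) = ennreal (\<Sum>k. \<beta> k)"
  by (intro suminf_ennreal2 beta_nonneg beta_summable)

lemma suminf_beta_nonneg: "0 \<le> (\<Sum>k. \<beta> k)"
  by (intro suminf_nonneg beta_summable beta_nonneg)

text \<open>A Wald inequality: the selection of parent \<open>l\<close> does not depend on its own
  offspring count, so each selected parent contributes the mean \<open>\<beta> k\<close>. It serves
  both for the rounds of the recursion and for the individuals without an immigrant
  ancestor.\<close>

lemma nn_integral_kids: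
  assumes S: "\<And>l. Measurable.pred nat_prod (S l)"
    and inv: "\<And>l v y. S l (v(Inr (n, k, l) := y)) \<longleftrightarrow> S l v"
    and le: "\<And>v. (\<Sum>l. if S l v then 1 else 0) \<le> Z v"
    and Z: "Z \<in> borel_measurable nat_prod" "(\<integral>\<^sup>+v. Z v \<partial>pmf_prod (data_law \<mu> \<beta>)) \<le> B"
  shows "(\<integral>\<^sup>+v. (\<Sum>l. if S l v then of_nat (kids v n k l) else 0) \<partial>pmf_prod (data_law \<mu> \<beta>))
    \<le> ennreal (\<beta> k) * B"
proof -
  let ?P = "pmf_prod (data_law \<mu> \<beta>)"
  note [measurable] = S Z(1)
  have "(\<integral>\<^sup>+v. (\<Sum>l. if S l v then of_nat (kids v n k l) else 0) \<partial>?P)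
      = (\<Sum>l. \<integral>\<^sup>+v. (if S l v then of_nat (kids v n k l) else 0) \<partial>?P)"
    by (intro nn_integral_suminf) measurable
  also have "\<dots> = (\<Sum>l. ennreal (\<beta> k) * emeasure ?P {v. S l v})"
    by (simp add: nn_integral_coordinate_indep[OF S inv] nn_integral_pois beta_nonneg mult.commute)
  also have "\<dots> = ennreal (\<beta> k) * (\<Sum>l. emeasure ?P {v. S l v})"
    by (rule ennreal_suminf_cmult)
  also have "(\<Sum>l. emeasure ?P {v. S l v}) = (\<Sum>l. \<integral>\<^sup>+v. indicator {v. S l v} v \<partial>?P)"
    by (intro suminf_cong nn_integral_indicator[symmetric] sets_Collect_pmf_prod S)
  also have "\<dots> = (\<integral>\<^sup>+v. (\<Sum>l. indicator {v. S l v} v) \<partial>?P)"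
    by (intro nn_integral_suminf[symmetric] borel_measurable_indicator sets_Collect_pmf_prod S)
  also have "\<dots> \<le> (\<integral>\<^sup>+v. Z v \<partial>?P)"
    using le by (intro nn_integral_mono) (simp add: indicator_def of_bool_def)
  also note Z(2)
  finally show ?thesis by (simp add: mult_left_mono)
qed

lemma nn_integral_tot_le:
  assumes \<mu>: "\<And>n. (\<integral>\<^sup>+x. of_nat x \<partial>measure_pmf (\<mu> n)) \<le> ennreal c" and c: "0 \<le> c"
  shows "(\<integral>\<^sup>+v. tot v n \<partial>pmf_prod (data_law \<mu> \<beta>)) \<le> ennreal (c / (1 - (\<Sum>k. \<beta> k)))"
proof -
  let ?P = "pmf_prod (data_law \<mu> \<beta>)"
  let ?a = "\<Sum>k. \<beta> k"
  \<comment> \<open>\<open>B\<close> is the fixed point of \<open>x \<mapsto> c + a x\<close>, so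
    the bound reproduces itself from one round to the next.\<close>
  define B where "B = c / (1 - ?a)"
  have B: "0 \<le> B" "c + ?a * B = B"
    using c beta_less_1 by (auto simp: B_def field_simps)
  have "(\<integral>\<^sup>+v. approx r v n \<partial>?P) \<le> ennreal B" for r n
  proof (induction r arbitrary: n)
    case (Suc r)
    have "(\<integral>\<^sup>+v. approx (Suc r) v n \<partial>?P) = (\<integral>\<^sup>+v. of_nat (immi v n) \<partial>?P) +
        (\<Sum>k. \<integral>\<^sup>+v. (\<Sum>l. if of_nat l < approx r v (n - 1 - int k) then of_nat (kids v n k l) else 0) \<partial>?P)"
      unfolding approx.simps by (subst nn_integral_add) (auto intro!: nn_integral_suminf)
    also have "\<dots> \<le> ennreal c + (\<Sum>k. ennreal (\<beta> k) * ennreal B)"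
    proof (intro add_mono suminf_le summableI)
      show "(\<integral>\<^sup>+v. of_nat (immi v n) \<partial>?P) \<le> ennreal c"
        using nn_integral_coordinate_indep[of "\<lambda>_. True" "Inl n" "data_law \<mu> \<beta>"] \<mu>[of n]
          prob_space.emeasure_space_1[OF prob_space_pmf_prod[of "data_law \<mu> \<beta>"]]
        by simp
      show "(\<integral>\<^sup>+v. (\<Sum>l. if of_nat l < approx r v (n - 1 - int k) then of_nat (kids v n k l) else 0) \<partial>?P)
          \<le> ennreal (\<beta> k) * ennreal B" for k
      proof (rule nn_integral_kids[OF _ _ _ _ Suc.IH])
        show "Measurable.pred nat_prod (\<lambda>v. of_nat l < approx r v (n - 1 - int k))" for l
          by measurable
        show "(of_nat l < approx r (v(Inr (n, k, l) := y)) (n - 1 - int k))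
            = (of_nat l < approx r v (n - 1 - int k))" for l v y
          by (subst approx_cong[OF agree_upd]) auto
        show "(\<Sum>l. if of_nat l < approx r v (n - 1 - int k) then 1 else 0)
            \<le> approx r v (n - 1 - int k)" for v
          by (rule count_below_le[OF ext_nat_approx])
      qed (rule measurable_approx)
    qed
    also have "\<dots> = ennreal B"
      using B c suminf_beta_nonneg
      by (simp add: suminf_beta flip: ennreal_mult ennreal_plus)
    finally show ?case .
  qed simp
  then show ?thesis
    unfolding tot_def B_def[symmetric]
    by (subst nn_integral_monotone_convergence_SUP)
      (auto simp: incseq_def le_fun_def intro: incseqD[OF incseq_approx] SUP_least)
qed

lemma AE_regular:
  assumes \<mu>: "\<And>n. (\<integral>\<^sup>+x. of_nat x \<partial>measure_pmf (\<mu> n)) \<le> ennreal c" and c: "0 \<le> c"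
  shows "AE v in pmf_prod (data_law \<mu> \<beta>). regular v"
  unfolding regular_def AE_all_countable
proof
  fix n
  have "(\<integral>\<^sup>+v. tot v n \<partial>pmf_prod (data_law \<mu> \<beta>)) \<noteq> \<infinity>"
    using nn_integral_tot_le[where \<mu>=\<mu> and n=n, OF \<mu> c] by (auto simp: top_unique)
  then have "AE v in pmf_prod (data_law \<mu> \<beta>). tot v n \<noteq> \<infinity>"
    by (intro nn_integral_noteq_infinite) auto
  then show "AE v in pmf_prod (data_law \<mu> \<beta>). tot v n \<noteq> \<top>"
    by simp
qed

end

section \<open>Families of individuals\<close>

text \<open>The individuals alive at time \<open>n\<close> are labelled \<open>0, \<dots>, pop v n - 1\<close>: first the immigrants,
  then, in lexicographic order of \<open>(k, l)\<close>, the children of the individual labelled \<open>l\<close> at time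
  \<open>n - 1 - k\<close>.\<close>

definition start :: "inar_data \<Rightarrow> int \<Rightarrow> nat \<Rightarrow> nat" where
  "start v n k = immi v n + (\<Sum>k'<k. \<Sum>l<pop v (n - 1 - int k'). kids v n k' l)"

text \<open>The block of children is cut at \<open>pop v n\<close>. On regular data and for parents
  below the population nothing is lost (\<open>card_child\<close>); on other data the cut keeps
  clans finite and below the population, so that they stay disjoint for every
  \<open>v\<close>.\<close>

definition child :: "inar_data \<Rightarrow> int \<Rightarrow> nat \<Rightarrow> nat \<Rightarrow> nat set" where
  "child v n k l =
     {start v n k + (\<Sum>l'<l. kids v n k l') ..< start v n k + (\<Sum>l'<Suc l. kids v n k l')}
       \<inter> {..<pop v n}"

text \<open>The labels at time \<open>t\<close> of the generation \<open>g\<close> descendants of immigrant \<open>j\<close> of time \<open>i\<close>.\<close>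

primrec clan :: "inar_data \<Rightarrow> int \<Rightarrow> nat \<Rightarrow> nat \<Rightarrow> int \<Rightarrow> nat set" where
  "clan v i j 0 t = (if t = i \<and> j < immi v i then {j} \<inter> {..<pop v t} else {})"
| "clan v i j (Suc g) t = (\<Union>k. \<Union>l\<in>clan v i j g (t - 1 - int k). child v t k l)"

lemma start_mono: "k \<le> k' \<Longrightarrow> start v n k \<le> start v n k'"
  unfolding start_def by (intro add_left_mono sum_mono2) auto

lemma child_ge: "x \<in> child v n k l \<Longrightarrow> immi v n \<le> x"
  by (auto simp: child_def start_def)

lemma child_less_start:
  assumes "x \<in> child v n k l" "l < pop v (n - 1 - int k)"
  shows "x < start v n (Suc k)"
proof -
  have "(\<Sum>l'<Suc l. kids v n k l') \<le> (\<Sum>l'<pop v (n - 1 - int k). kids v n k l')"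
    using assms(2) by (intro sum_mono2) auto
  with assms(1) show ?thesis by (auto simp: child_def start_def)
qed

text \<open>The blocks are consecutive intervals. A parent label below the population of its time
  keeps its block before the start of the next lag, which separates different lags.\<close>

lemma child_inj:
  assumes x: "x \<in> child v n k l" "x \<in> child v n k' l'"
    and l: "l < pop v (n - 1 - int k)" "l' < pop v (n - 1 - int k')"
  shows "k = k' \<and> l = l'"
proof -
  have k: "\<not> k1 < k2" if "x \<in> child v n k1 l1" "x \<in> child v n k2 l2" "l1 < pop v (n - 1 - int k1)"
    for k1 k2 l1 l2
  proof
    assume "k1 < k2"
    then have "start v n (Suc k1) \<le> start v n k2"
      by (intro start_mono) auto
    then show False
      using child_less_start[OF that(1,3)] that(2) by (auto simp: child_def)
  qed
  have kk: "k = k'"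
    using k[OF x l(1)] k[OF x(2,1) l(2)] by auto
  have nless: "\<not> l1 < l2" if "x \<in> child v n k l1" "x \<in> child v n k l2" for l1 l2
  proof
    assume "l1 < l2"
    then have "(\<Sum>l'<Suc l1. kids v n k l') \<le> (\<Sum>l'<l2. kids v n k l')"
      by (intro sum_mono2) auto
    then show False using that by (auto simp: child_def)
  qed
  have "\<not> l < l'" "\<not> l' < l"
    using nless x kk by blast+
  with kk show ?thesis by simp
qed

lemma clan_subset: "clan v i j g t \<subseteq> {..<pop v t}"
  by (cases g) (auto simp: child_def)

lemma finite_clan [simp]: "finite (clan v i j g t)"
  by (rule finite_subset[OF clan_subset]) simp

lemma clan_before: "t < i \<Longrightarrow> clan v i j g t = {}"
  by (induction g arbitrary: t) auto

lemma clan_immi: "x \<in> clan v i j g t \<Longrightarrow> j < immi v i"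
  by (induction g arbitrary: x t) (auto split: if_splits)

text \<open>A label determines its parent and the lag, so two clans through \<open>x\<close> already
  meet one generation earlier. Immigrants have labels below \<open>immi\<close> and children do not,
  so both descents end together, which matches the generation numbers.\<close>

lemma clan_disjoint:
  "x \<in> clan v i j g t \<Longrightarrow> x \<in> clan v i' j' g' t \<Longrightarrow> i = i' \<and> j = j' \<and> g = g'"
proof (induction g arbitrary: g' t x)
  case 0
  then show ?case by (cases g') (auto split: if_splits dest: child_ge)
next
  case (Suc g)
  obtain k l where kl: "l \<in> clan v i j g (t - 1 - int k)" "x \<in> child v t k l"
    using Suc.prems(1) by auto
  have "g' \<noteq> 0"
    using Suc.prems(2) child_ge[OF kl(2)] by (intro notI) (auto split: if_splits)
  then obtain h where h: "g' = Suc h" by (cases g') auto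
  obtain k' l' where kl': "l' \<in> clan v i' j' h (t - 1 - int k')" "x \<in> child v t k' l'"
    using Suc.prems(2) h by auto
  have "k = k' \<and> l = l'"
    using kl(1) kl'(1) clan_subset by (intro child_inj[OF kl(2) kl'(2)]) blast+
  then show ?case
    using Suc.IH[OF kl(1), of h] kl'(1) h by auto
qed

lemma start_cong:
  assumes "agree n v v'"
  shows "start v n k = start v' n k"
proof -
  have "pop v (n - 1 - int k') = pop v' (n - 1 - int k')" for k'
    by (rule pop_cong[OF agree_mono[OF assms]]) simp
  moreover have "immi v n = immi v' n" "kids v n k' l = kids v' n k' l" for k' l
    using agreeD[OF assms] by simp_all
  ultimately show ?thesis by (simp only: start_def)
qed

lemma child_cong:
  assumes "agree n v v'"
  shows "child v n k l = child v' n k l"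
proof -
  have "kids v n k l = kids v' n k l" for l
    using agreeD[OF assms] by simp
  then show ?thesis
    by (simp only: child_def start_cong[OF assms] pop_cong[OF assms])
qed

lemma clan_cong: "agree t v v' \<Longrightarrow> clan v i j g t = clan v' i j g t"
proof (induction g arbitrary: t)
  case 0
  then show ?case using agreeD[OF 0, of "Inl i"] pop_cong[OF 0] by auto
next
  case (Suc g)
  have "clan v i j g (t - 1 - int k) = clan v' i j g (t - 1 - int k)" for k
    by (rule Suc.IH[OF agree_mono[OF Suc.prems]]) simp
  then show ?case by (simp add: child_cong[OF Suc.prems])
qed

section \<open>Measurability of clans and labels\<close>

lemma measurable_random_sum:
  fixes f :: "nat \<Rightarrow> 'a \<Rightarrow> nat"
  assumes [measurable]: "\<And>m. f m \<in> measurable M nat_space" and G: "G \<in> measurable M nat_space"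
  shows "(\<lambda>x. \<Sum>m<G x. f m x) \<in> measurable M nat_space"
    and "(\<lambda>x. \<Sum>m=1..G x. f m x) \<in> measurable M nat_space"
  by (rule measurable_compose_countable[OF _ G, where f="\<lambda>N x. \<Sum>m<N. f m x"]; simp)
     (rule measurable_compose_countable[OF _ G, where f="\<lambda>N x. \<Sum>m=1..N. f m x"]; simp)

lemma measurable_nat_rel:
  assumes f: "f \<in> measurable M nat_space" and g: "g \<in> measurable M nat_space"
  shows "Measurable.pred M (\<lambda>x. R (f x :: nat) (g x :: nat))"
proof (rule measurable_compose_countable[OF _ g])
  show "Measurable.pred M (\<lambda>x. R (f x) n)" for n
    by (rule measurable_compose[OF f]) simp
qed

lemma measurable_start [measurable]: "(\<lambda>v. start v n k) \<in> measurable nat_prod nat_space"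
proof -
  have [measurable]: "(\<lambda>v. \<Sum>l<pop v (n - 1 - int k'). kids v n k' l) \<in> measurable nat_prod nat_space" for k'
    by (rule measurable_random_sum) simp_all
  show ?thesis unfolding start_def by measurable
qed

lemma measurable_in_child [measurable]: "Measurable.pred nat_prod (\<lambda>v. x \<in> child v n k l)"
proof -
  have [measurable]: "(\<lambda>v. \<Sum>l'<l. kids v n k l') \<in> measurable nat_prod nat_space" for l
    by measurable
  show ?thesis
    unfolding child_def Int_iff atLeastLessThan_iff lessThan_iff
    by (intro pred_intros_logic measurable_nat_rel) measurable
qed

lemma measurable_in_clan [measurable]: "Measurable.pred nat_prod (\<lambda>v. x \<in> clan v i j g t)"
proof (induction g arbitrary: x t)
  case 0
  have "x \<in> clan v i j 0 t \<longleftrightarrow> t = i \<and> j < immi v i \<and> x = j \<and> x < pop v t" for v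
    by auto
  then show ?case by simp
next
  case (Suc g)
  note [measurable] = Suc.IH
  have "x \<in> clan v i j (Suc g) t \<longleftrightarrow>
      (\<exists>k l. l \<in> clan v i j g (t - 1 - int k) \<and> x \<in> child v t k l)" for v
    by auto
  then show ?case by simp
qed

text \<open>Finite sets of labels form a countable space, so membership events suffice, and
  arbitrary functions of a clan, such as \<open>card\<close> and \<open>enumerate\<close>, become
  measurable.\<close>

lemma measurable_clan:
  "(\<lambda>v. clan v i j g t) \<in> measurable nat_prod (count_space {S. finite S})"
proof (subst measurable_count_space_eq_countable)
  show "countable {S :: nat set. finite S}"
    using countable_Collect_finite by simp
  have "(\<lambda>v. clan v i j g t) -` {S} \<inter> space nat_prod \<in> sets nat_prod" for S
  proof -
    have "Measurable.pred nat_prod (\<lambda>v. \<forall>x. x \<in> clan v i j g t \<longleftrightarrow> x \<in> S)"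
      by measurable
    then show ?thesis
      by (simp add: pred_def vimage_def space_PiM set_eq_iff)
  qed
  then show "(\<lambda>v. clan v i j g t) \<in> space nat_prod \<rightarrow> {S. finite S} \<and>
      (\<forall>S\<in>{S. finite S}. (\<lambda>v. clan v i j g t) -` {S} \<inter> space nat_prod \<in> sets nat_prod)"
    by auto
qed

text \<open>Member \<open>m\<close> of a clan has its true label if it exists, and otherwise a label above \<open>pop v t\<close>,
  whose offspring counts nobody alive uses.\<close>

definition label :: "inar_data \<Rightarrow> int \<Rightarrow> int \<Rightarrow> nat \<Rightarrow> nat \<Rightarrow> nat \<Rightarrow> nat" where
  "label v t i j g m =
     (if m < card (clan v i j g t) then enumerate (clan v i j g t) m
      else pop v t + to_nat (i, j, g, m))"

lemma bij_betw_label: "bij_betw (label v t i j g) {..<card (clan v i j g t)} (clan v i j g t)"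
  using finite_bij_enumerate[OF finite_clan]
  by (rule bij_betw_cong[THEN iffD1, rotated]) (simp add: label_def)

lemma label_inj:
  assumes eq: "label v t i j g m = label v t i' j' g' m'"
  shows "i = i' \<and> j = j' \<and> g = g' \<and> m = m'"
proof -
  let ?c = "card (clan v i j g t)" and ?c' = "card (clan v i' j' g' t)"
  have in_clan: "label v t i j g m \<in> clan v i j g t" if "m < card (clan v i j g t)" for i j g m
    using bij_betw_apply[OF bij_betw_label] that by simp
  have less: "label v t i j g m < pop v t" if "m < card (clan v i j g t)" for i j g m
    using in_clan[OF that] clan_subset by blast
  have ge: "label v t i j g m = pop v t + to_nat (i, j, g, m)" if "\<not> m < card (clan v i j g t)"
    for i j g m
    using that by (simp add: label_def)
  show ?thesis
  proof (cases "m < ?c")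
    case True
    then have m': "m' < ?c'"
      using less[OF True] ge[of m' i' j' g'] eq by (intro ccontr[of "m' < ?c'"]) simp
    have "i = i' \<and> j = j' \<and> g = g'"
      using in_clan[OF True] in_clan[OF m'] eq by (intro clan_disjoint) auto
    moreover from this have "m = m'"
      using bij_betw_imp_inj_on[OF bij_betw_label] eq True m' by (metis inj_onD lessThan_iff)
    ultimately show ?thesis by blast
  next
    case False
    then have "\<not> m' < ?c'"
      using less[of m' i' j' g'] ge[OF False] eq by auto
    then have "to_nat (i, j, g, m) = to_nat (i', j', g', m')"
      using ge[OF False] ge[of m' i' j' g'] eq by linarith
    from injD[OF inj_to_nat this] show ?thesis by simp
  qed
qed

lemma label_cong: "agree t v v' \<Longrightarrow> label v t i j g m = label v' t i j g m"
  by (simp add: label_def clan_cong pop_cong)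

lemma measurable_label [measurable]: "(\<lambda>v. label v t i j g m) \<in> measurable nat_prod nat_space"
proof -
  have [measurable]: "(\<lambda>v. h (clan v i j g t)) \<in> measurable nat_prod (count_space UNIV)"
    for h :: "nat set \<Rightarrow> 'z"
    by (rule measurable_compose[OF measurable_clan]) simp
  have [measurable]: "(\<lambda>v. enumerate (clan v i j g t) m) \<in> measurable nat_prod nat_space"
    "(\<lambda>v. card (clan v i j g t)) \<in> measurable nat_prod nat_space"
    by measurable
  show ?thesis unfolding label_def by measurable
qed

section \<open>The clans are independent branching processes\<close>

type_synonym offspring_data = "int \<times> nat \<times> nat \<times> nat \<Rightarrow> nat"

text \<open>Coordinate \<open>(n, k, g, m)\<close> of \<open>z\<close> plays the role of \<open>\<zeta> n (Suc k) (Suc g) (Suc m)\<close>.\<close>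

definition coord :: "int \<Rightarrow> nat \<Rightarrow> nat \<Rightarrow> nat \<Rightarrow> offspring_data \<Rightarrow> nat" where
  "coord n k g m z = z (n, k - 1, g - 1, m - 1)"

lemma generation_coord_Suc:
  "generation coord (Suc g) n z =
     (\<Sum>k<nat n. \<Sum>m<generation coord g (n - 1 - int k) z. z (n, k, g, m))"
  by (simp add: coord_def sum.atLeast1_atMost_eq algebra_simps)

text \<open>\<open>sel (Inr ((i, j), y)) v\<close> is the coordinate of \<open>v\<close> that serves as coordinate \<open>y\<close> of the offspring
  array of the clan founded by immigrant \<open>j\<close> of time \<open>i\<close>.\<close>

fun sel :: "int + (int \<times> nat) \<times> int \<times> nat \<times> nat \<times> nat \<Rightarrow> inar_data \<Rightarrow> int + int \<times> nat \<times> nat" where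
  "sel (Inl n) v = Inl n"
| "sel (Inr ((i, j), s, k, g, m)) v = Inr (i + s, k, label v (i + s - 1 - int k) i j g m)"

definition arr :: "inar_data \<Rightarrow> int \<Rightarrow> nat \<Rightarrow> offspring_data" where
  "arr v i j = (\<lambda>y. v (sel (Inr ((i, j), y)) v))"

definition cluster_law ::
  "(int \<Rightarrow> nat pmf) \<Rightarrow> (nat \<Rightarrow> real) \<Rightarrow> int + (int \<times> nat) \<times> int \<times> nat \<times> nat \<times> nat \<Rightarrow> nat pmf" where
  "cluster_law \<mu> \<beta> q = (case q of Inl n \<Rightarrow> \<mu> n | Inr (_, _, k, _, _) \<Rightarrow> pois (\<beta> k))"

lemma distr_sel:
  shows "(\<lambda>v q. v (sel q v)) \<in> measurable nat_prod nat_prod"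
    and "distr (pmf_prod (data_law \<mu> \<beta>)) nat_prod (\<lambda>v q. v (sel q v)) = pmf_prod (cluster_law \<mu> \<beta>)"
proof -
  \<comment> \<open>Immigration is placed before all times, so labels may consult it freely; an
    offspring count belongs to the time at which the children are born.\<close>
  define row :: "int + int \<times> nat \<times> nat \<Rightarrow> ereal" where
    "row b = (case b of Inl _ \<Rightarrow> -\<infinity> | Inr (n, _, _) \<Rightarrow> ereal (real_of_int n))" for b
  define \<rho> :: "int + (int \<times> nat) \<times> int \<times> nat \<times> nat \<times> nat \<Rightarrow> ereal" where
    "\<rho> q = (case q of Inl _ \<Rightarrow> -\<infinity> | Inr ((i, _), s, _) \<Rightarrow> ereal (real_of_int (i + s)))" for q
  have 1: "sel q \<in> measurable nat_prod (count_space UNIV)" for q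
  proof (cases "(q, undefined :: inar_data)" rule: sel.cases)
    case (2 i j s k g m v)
    have "(\<lambda>v. Inr (i + s, k, label v (i + s - 1 - int k) i j g m) :: int + int \<times> nat \<times> nat)
        \<in> measurable nat_prod (count_space UNIV)"
      by (rule measurable_compose[OF measurable_label]) simp
    moreover have "sel q = (\<lambda>v. Inr (i + s, k, label v (i + s - 1 - int k) i j g m))"
      using 2 by (auto simp: fun_eq_iff)
    ultimately show ?thesis by simp
  next
    case (1 n v)
    then have "sel q = (\<lambda>v. Inl n)" by (auto simp: fun_eq_iff)
    then show ?thesis by simp
  qed
  have 2: "row (sel q v) = \<rho> q" for q v
    by (cases "(q, v)" rule: sel.cases) (auto simp: row_def \<rho>_def)
  have 3: "sel q v = sel q v'" if eq: "\<And>b. row b < \<rho> q \<Longrightarrow> v b = v' b" for q v v'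
  proof (cases "(q, v)" rule: sel.cases)
    case (2 i j s k g m)
    \<comment> \<open>The label refers to the time of the parent, at least one step before the row
      \<open>i + s\<close>.\<close>
    have "agree (i + s - 1 - int k) v v'"
      unfolding agree_def
    proof (intro allI impI eq)
      fix b assume "time b \<le> i + s - 1 - int k"
      then show "row b < \<rho> q"
        using 2 by (auto simp: row_def \<rho>_def time_def split: sum.splits prod.splits)
    qed
    then show ?thesis using 2 label_cong by auto
  qed auto
  have 4: "inj (\<lambda>q. sel q v)" for v
  proof (rule injI)
    fix p q assume "sel p v = sel q v"
    then show "p = q"
      by (cases "(p, v)" rule: sel.cases; cases "(q, v)" rule: sel.cases) (auto dest!: label_inj)
  qed
  have 5: "data_law \<mu> \<beta> (sel q v) = cluster_law \<mu> \<beta> q" for q v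
    by (cases "(q, v)" rule: sel.cases) (auto simp: cluster_law_def)
  show "(\<lambda>v q. v (sel q v)) \<in> measurable nat_prod nat_prod"
    and "distr (pmf_prod (data_law \<mu> \<beta>)) nat_prod (\<lambda>v q. v (sel q v)) = pmf_prod (cluster_law \<mu> \<beta>)"
    using distr_relabel[of sel row \<rho> "data_law \<mu> \<beta>" "cluster_law \<mu> \<beta>", OF 1 2 3 4 5] by auto
qed

section \<open>Regular data: clan sizes are generation sizes\<close>

lemma start_le_pop:
  assumes "regular v"
  shows "start v n k \<le> pop v n"
proof -
  let ?c = "\<lambda>k. \<Sum>l<pop v (n - 1 - int k). kids v n k l"
  have "(\<Sum>k'<k. of_nat (?c k')) \<le> (\<Sum>k. of_nat (?c k) :: ennreal)"
    by (intro sum_le_suminf) auto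
  then have "(of_nat (start v n k) :: ennreal) \<le> of_nat (pop v n)"
    unfolding pop_eq[OF assms] start_def by (simp add: add_left_mono)
  then show ?thesis by (simp only: of_nat_le_iff)
qed

text \<open>A finite population receives children from finitely many lags only.\<close>

lemma ex_start_eq_pop:
  assumes "regular v"
  shows "\<exists>k. pop v n \<le> start v n k"
proof -
  let ?c = "\<lambda>k. \<Sum>l<pop v (n - 1 - int k). kids v n k l"
  have "(\<Sum>k. of_nat (?c k) :: ennreal) \<noteq> \<top>"
  proof
    assume "(\<Sum>k. of_nat (?c k) :: ennreal) = \<top>"
    then have "(of_nat (pop v n) :: ennreal) = \<top>"
      unfolding pop_eq[OF assms, of n] by simp
    then show False by simp
  qed
  then have fin: "finite {k. ?c k \<noteq> 0}"
    by (rule suminf_of_nat_finite_support)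
  then obtain K where K: "{k. ?c k \<noteq> 0} \<subseteq> {..<K}"
    using finite_nat_iff_bounded by blast
  have "(of_nat (pop v n) :: ennreal) = of_nat (immi v n + (\<Sum>k\<in>{k. ?c k \<noteq> 0}. ?c k))"
    unfolding pop_eq[OF assms, of n] suminf_of_nat_eq[OF fin] by (simp only: of_nat_add)
  then have "pop v n = immi v n + (\<Sum>k\<in>{k. ?c k \<noteq> 0}. ?c k)"
    by (simp only: of_nat_eq_iff)
  also have "\<dots> \<le> start v n K"
    unfolding start_def by (intro add_left_mono sum_mono2 K) auto
  finally show ?thesis ..
qed

lemma immi_le_pop: "regular v \<Longrightarrow> immi v n \<le> pop v n"
  using start_le_pop[of v n 0] by (simp add: start_def)

lemma card_child:
  assumes "regular v" "l < pop v (n - 1 - int k)"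
  shows "card (child v n k l) = kids v n k l"
proof -
  have "(\<Sum>l'<Suc l. kids v n k l') \<le> (\<Sum>l'<pop v (n - 1 - int k). kids v n k l')"
    using assms(2) by (intro sum_mono2) auto
  then have "start v n k + (\<Sum>l'<Suc l. kids v n k l') \<le> start v n (Suc k)"
    by (simp add: start_def)
  also have "\<dots> \<le> pop v n" by (rule start_le_pop[OF assms(1)])
  finally have "child v n k l =
      {start v n k + (\<Sum>l'<l. kids v n k l') ..< start v n k + (\<Sum>l'<Suc l. kids v n k l')}"
    unfolding child_def by auto
  then show ?thesis by simp
qed

text \<open>The first lag whose block ends beyond \<open>x\<close> and, inside that lag, the first
  parent whose block ends beyond \<open>x\<close> are the ones sought.\<close>

lemma child_cover:
  assumes "regular v" and x: "x < pop v n" "immi v n \<le> x"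
  shows "\<exists>k l. l < pop v (n - 1 - int k) \<and> x \<in> child v n k l"
proof -
  have "\<exists>k. x < start v n k"
    using ex_start_eq_pop[OF assms(1), of n] x(1) by (meson less_le_trans)
  then obtain k where k: "x < start v n k" "\<And>k'. k' < k \<Longrightarrow> \<not> x < start v n k'"
    using exists_least_iff[of "\<lambda>k. x < start v n k"] by blast
  have "k \<noteq> 0" using k(1) x(2) by (intro notI) (simp add: start_def)
  then obtain k0 where k0: "k = Suc k0" by (cases k) auto
  have s0: "start v n k0 \<le> x" using k(2)[of k0] k0 by simp
  let ?s = "\<lambda>l. start v n k0 + (\<Sum>l'<l. kids v n k0 l')"
  have top: "x < ?s (pop v (n - 1 - int k0))"
    using k(1) by (simp add: k0 start_def)
  then obtain l where l: "x < ?s l" "\<And>l'. l' < l \<Longrightarrow> \<not> x < ?s l'"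
    using exists_least_iff[of "\<lambda>l. x < ?s l"] by blast
  have "l \<noteq> 0" using l(1) s0 by (intro notI) simp
  then obtain l0 where l0: "l = Suc l0" by (cases l) auto
  have "l \<le> pop v (n - 1 - int k0)"
    using l(2)[of "pop v (n - 1 - int k0)"] top by (meson not_le)
  moreover have "x \<in> child v n k0 l0"
    using l(1) l(2)[of l0] x(1) unfolding child_def by (auto simp: l0)
  ultimately show ?thesis using l0 by (metis Suc_le_lessD)
qed

text \<open>By the bijection \<open>label\<close>, summing over member numbers is summing over true
  labels. The blocks of children of different members are disjoint, so their sizes add up to the
  size of the next generation of the clan.\<close>

lemma generation_arr:
  assumes v: "regular v" and j: "j < immi v i"
  shows "generation coord g s (arr v i j) = card (clan v i j g (i + s))"
proof (induction g arbitrary: s)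
  case 0
  have "j < pop v i" using immi_le_pop[OF v, of i] j by simp
  then show ?case using j by simp
next
  case (Suc g)
  have IH: "generation coord g (s - 1 - int k) (arr v i j) = card (clan v i j g (i + s - 1 - int k))" for k
    using Suc.IH[of "s - 1 - int k"] by (simp add: algebra_simps)
  let ?A = "SIGMA k:{..<nat s}. clan v i j g (i + s - 1 - int k)"
  have "generation coord (Suc g) s (arr v i j) =
      (\<Sum>k<nat s. \<Sum>m<card (clan v i j g (i + s - 1 - int k)).
         kids v (i + s) k (label v (i + s - 1 - int k) i j g m))"
    by (simp only: generation_coord_Suc IH) (simp add: arr_def)
  also have "\<dots> = (\<Sum>k<nat s. \<Sum>l\<in>clan v i j g (i + s - 1 - int k). kids v (i + s) k l)"
    by (intro sum.cong refl sum.reindex_bij_betw[OF bij_betw_label])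
  also have "\<dots> = (\<Sum>(k, l)\<in>?A. kids v (i + s) k l)"
    by (rule sum.Sigma) auto
  also have "\<dots> = (\<Sum>p\<in>?A. card (child v (i + s) (fst p) (snd p)))"
  proof (rule sum.cong)
    fix p assume "p \<in> ?A"
    then show "(case p of (k, l) \<Rightarrow> kids v (i + s) k l) = card (child v (i + s) (fst p) (snd p))"
      using subsetD[OF clan_subset[of v i j g "i + s - 1 - int (fst p)"], of "snd p"]
      by (auto intro!: card_child[OF v, symmetric])
  qed simp
  also have "\<dots> = card (\<Union>p\<in>?A. child v (i + s) (fst p) (snd p))"
  proof (rule card_UN_disjoint[symmetric])
    show "\<forall>p\<in>?A. \<forall>q\<in>?A. p \<noteq> q \<longrightarrow>
        child v (i + s) (fst p) (snd p) \<inter> child v (i + s) (fst q) (snd q) = {}"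
    proof (intro ballI impI)
      fix p q assume pq: "p \<in> ?A" "q \<in> ?A" "p \<noteq> q"
      have "snd p < pop v (i + s - 1 - int (fst p))" "snd q < pop v (i + s - 1 - int (fst q))"
        using pq(1,2) subsetD[OF clan_subset[of v i j g "i + s - 1 - int (fst p)"], of "snd p"]
          subsetD[OF clan_subset[of v i j g "i + s - 1 - int (fst q)"], of "snd q"] by auto
      then show "child v (i + s) (fst p) (snd p) \<inter> child v (i + s) (fst q) (snd q) = {}"
        using child_inj pq(3) by (metis disjoint_iff prod.expand)
    qed
  qed (auto simp: child_def)
  also have "(\<Union>p\<in>?A. child v (i + s) (fst p) (snd p)) = clan v i j (Suc g) (i + s)"
  proof -
    \<comment> \<open>Lags from \<open>nat s\<close> on lead to times before the arrival of the
      founder.\<close>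
    have "k < nat s" if "l \<in> clan v i j g (i + s - 1 - int k)" for k l
      using that clan_before[of "i + s - 1 - int k" i v j g] by (intro ccontr[of "k < nat s"]) auto
    then show ?thesis by fastforce
  qed
  finally show ?case .
qed

lemma branching_arr:
  assumes "regular v" "j < immi v i"
  shows "branching coord (n - i) (arr v i j) = (\<Sum>g\<le>nat (n - i). card (clan v i j g n))"
  by (simp add: branching_eq generation_arr[OF assms])

section \<open>Individuals without an immigrant ancestor\<close>

definition orphans :: "inar_data \<Rightarrow> int \<Rightarrow> nat set" where
  "orphans v t = {..<pop v t} - (\<Union>i. \<Union>j. \<Union>g. clan v i j g t)"

lemma orphans_cong: "agree t v v' \<Longrightarrow> orphans v t = orphans v' t"
  by (simp add: orphans_def pop_cong clan_cong)

lemma measurable_in_orphans [measurable]: "Measurable.pred nat_prod (\<lambda>v. x \<in> orphans v t)"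
proof -
  have "x \<in> orphans v t \<longleftrightarrow> x < pop v t \<and> \<not> (\<exists>i j g. x \<in> clan v i j g t)" for v
    by (auto simp: orphans_def)
  then show ?thesis by simp
qed

text \<open>An immigrant would found a clan, so \<open>x\<close> has a parent; a parent in a clan
  would put \<open>x\<close> into the next generation of that clan.\<close>

lemma orphans_parent:
  assumes v: "regular v" and x: "x \<in> orphans v t"
  shows "\<exists>k. \<exists>l\<in>orphans v (t - 1 - int k). x \<in> child v t k l"
proof -
  have "x < pop v t" using x by (simp add: orphans_def)
  moreover have "immi v t \<le> x"
  proof (rule ccontr)
    assume "\<not> immi v t \<le> x"
    then have "x \<in> clan v t x 0 t" using \<open>x < pop v t\<close> by simp
    then show False using x unfolding orphans_def by blast
  qed
  ultimately obtain k l where kl: "l < pop v (t - 1 - int k)" "x \<in> child v t k l"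
    using child_cover[OF v] by blast
  have "l \<notin> clan v i j g (t - 1 - int k)" for i j g
  proof
    assume "l \<in> clan v i j g (t - 1 - int k)"
    then have "x \<in> clan v i j (Suc g) t" using kl by auto
    then show False using x unfolding orphans_def by blast
  qed
  with kl(1) have "l \<in> orphans v (t - 1 - int k)" by (simp add: orphans_def)
  with kl(2) show ?thesis by blast
qed

text \<open>The children of orphans cover the orphans of time \<open>t\<close>, and counting measure
  is subadditive. The right-hand side has the form required by
  \<open>nn_integral_kids\<close>.\<close>

lemma card_orphans_le:
  assumes v: "regular v"
  shows "(\<Sum>x. if x \<in> orphans v t then 1 else 0 :: ennreal)
    \<le> (\<Sum>k. \<Sum>l. if l \<in> orphans v (t - 1 - int k) then of_nat (kids v t k l) else 0)"
proof -
  let ?c = "count_space (UNIV :: nat set)"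
  let ?S = "\<lambda>k l. if l \<in> orphans v (t - 1 - int k) then child v t k l else {}"
  have "(\<Sum>x. if x \<in> orphans v t then 1 else 0) = (\<integral>\<^sup>+x. indicator (orphans v t) x \<partial>?c)"
    by (simp add: nn_integral_count_space_nat indicator_def of_bool_def)
  also have "\<dots> = emeasure ?c (orphans v t)"
    by simp
  also have "\<dots> \<le> emeasure ?c (\<Union>k. \<Union>l. ?S k l)"
    using orphans_parent[OF v] by (intro emeasure_mono) fastforce+
  also have "\<dots> \<le> (\<Sum>k. emeasure ?c (\<Union>l. ?S k l))"
    by (rule emeasure_subadditive_countably) auto
  also have "\<dots> \<le> (\<Sum>k. \<Sum>l. emeasure ?c (?S k l))"
    by (intro suminf_le summableI emeasure_subadditive_countably) auto
  also have "\<dots> = (\<Sum>k. \<Sum>l. if l \<in> orphans v (t - 1 - int k) then of_nat (kids v t k l) else 0)"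
  proof -
    have "emeasure ?c (?S k l) = (if l \<in> orphans v (t - 1 - int k) then of_nat (kids v t k l) else 0)" for k l
    proof (cases "l \<in> orphans v (t - 1 - int k)")
      case True
      then have "card (child v t k l) = kids v t k l"
        by (intro card_child[OF v]) (simp add: orphans_def)
      moreover have "finite (child v t k l)" by (simp add: child_def)
      ultimately show ?thesis using True by (simp add: emeasure_count_space)
    qed simp
    then show ?thesis by simp
  qed
  finally show ?thesis .
qed

text \<open>Infinitely many immigrants could contribute a priori. Nonempty clans, however, are
  disjoint parts of a finite population, hence finite in number, and all other terms vanish.\<close>

lemma pop_eq_clans:
  assumes v: "regular v" and orphans: "orphans v n = {}"
  shows "(of_nat (pop v n) :: ennreal) =
    (\<Sum>\<^sub>\<infinity>i\<in>UNIV. of_nat (\<Sum>j<immi v i. branching coord (n - i) (arr v i j)))"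
proof -
  let ?clan = "\<lambda>(i, j, g). clan v i j g n"
  define I where "I = {p. ?clan p \<noteq> {}}"
  have UN: "(\<Union>p\<in>I. ?clan p) = {..<pop v n}"
  proof (intro equalityI subsetI)
    fix x assume "x \<in> {..<pop v n}"
    then obtain i j g where "x \<in> clan v i j g n"
      using orphans unfolding orphans_def by blast
    then show "x \<in> (\<Union>p\<in>I. ?clan p)"
      by (intro UN_I[of "(i, j, g)"]) (auto simp: I_def)
  qed (use clan_subset in fastforce)
  have disj: "?clan p \<inter> ?clan q = {}" if "p \<noteq> q" for p q
    using that by (auto dest: clan_disjoint)
  have Min_in_clan: "Min (?clan p) \<in> ?clan p" if "p \<in> I" for p
    using that by (intro Min_in) (cases p; simp add: I_def)+
  \<comment> \<open>Taking the least label injects the nonempty clans into the population.\<close>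
  have "finite I"
  proof (rule inj_on_finite)
    show "(\<lambda>p. Min (?clan p)) ` I \<subseteq> {..<pop v n}"
      unfolding UN[symmetric] using Min_in_clan by blast
    show "inj_on (\<lambda>p. Min (?clan p)) I"
    proof (rule inj_onI, rule ccontr)
      fix p q assume *: "p \<in> I" "q \<in> I" "Min (?clan p) = Min (?clan q)" "p \<noteq> q"
      show False
        using Min_in_clan[OF *(1)] Min_in_clan[OF *(2)] disj[OF *(4)] unfolding *(3) by blast
    qed
  qed simp
  let ?F = "fst ` I"
  \<comment> \<open>\<open>I\<close> is enlarged to nested index ranges, which turns the sum into an
    iterated one; the additional clans are empty.\<close>
  let ?S = "SIGMA i:?F. SIGMA j:{..<immi v i}. {..nat (n - i)}"
  have sub: "I \<subseteq> ?S"
  proof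
    fix p assume "p \<in> I"
    then obtain i j g where p: "p = (i, j, g)" and ne: "clan v i j g n \<noteq> {}"
      by (cases p) (auto simp: I_def)
    have j: "j < immi v i" using ne clan_immi by blast
    have "generation coord g (n - i) (arr v i j) \<noteq> 0"
      using ne generation_arr[OF v j, of g "n - i"] by simp
    then have "g \<le> nat (n - i)"
      using generation_eq_0[of "n - i" g coord "arr v i j"] by (cases "n - i < int g") auto
    then show "p \<in> ?S" using p j \<open>p \<in> I\<close> by force
  qed
  have "pop v n = card (\<Union>p\<in>I. ?clan p)" by (simp add: UN)
  also have "\<dots> = (\<Sum>p\<in>I. card (?clan p))"
    using \<open>finite I\<close> disj by (intro card_UN_disjoint) auto
  also have "\<dots> = (\<Sum>p\<in>?S. card (?clan p))"
    using \<open>finite I\<close> sub by (intro sum.mono_neutral_left) (auto simp: I_def)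
  also have "\<dots> = (\<Sum>i\<in>?F. \<Sum>j<immi v i. \<Sum>g\<le>nat (n - i). card (clan v i j g n))"
    using \<open>finite I\<close> by (simp add: sum.Sigma split_beta)
  also have "\<dots> = (\<Sum>i\<in>?F. \<Sum>j<immi v i. branching coord (n - i) (arr v i j))"
    by (simp add: branching_arr[OF v])
  finally have "(of_nat (pop v n) :: ennreal) =
      (\<Sum>i\<in>?F. of_nat (\<Sum>j<immi v i. branching coord (n - i) (arr v i j)))"
    by simp
  also have "\<dots> = (\<Sum>\<^sub>\<infinity>i\<in>?F. of_nat (\<Sum>j<immi v i. branching coord (n - i) (arr v i j)))"
    using \<open>finite I\<close> by (intro infsum_finite[symmetric]) auto
  also have "\<dots> = (\<Sum>\<^sub>\<infinity>i\<in>UNIV. of_nat (\<Sum>j<immi v i. branching coord (n - i) (arr v i j)))"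
  proof (rule infsum_cong_neutral)
    fix i assume i: "i \<in> UNIV - ?F"
    have "clan v i j g n = {}" for j g
      using i by (force simp: I_def)
    then have "branching coord (n - i) (arr v i j) = 0" if "j < immi v i" for j
      using that by (simp add: branching_arr[OF v])
    then show "of_nat (\<Sum>j<immi v i. branching coord (n - i) (arr v i j)) = (0 :: ennreal)"
      by simp
  qed auto
  finally show ?thesis .
qed

context subcritical
begin

lemma AE_orphans:
  assumes \<mu>: "\<And>n. (\<integral>\<^sup>+x. of_nat x \<partial>measure_pmf (\<mu> n)) \<le> ennreal c" and c: "0 \<le> c"
  shows "AE v in pmf_prod (data_law \<mu> \<beta>). \<forall>t. orphans v t = {}"
proof -
  let ?P = "pmf_prod (data_law \<mu> \<beta>)"
  let ?a = "\<Sum>k. \<beta> k"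
  define Z where "Z t v = (\<Sum>x. if x \<in> orphans v t then 1 else 0 :: ennreal)" for t v
  have Z [measurable]: "Z t \<in> borel_measurable nat_prod" for t
    unfolding Z_def by measurable
  define B where "B = (SUP t. \<integral>\<^sup>+v. Z t v \<partial>?P)"
  have Z_le: "Z t v \<le> tot v t" for t v
  proof (cases "tot v t = \<top>")
    case False
    have "Z t v \<le> (\<Sum>x. if of_nat x < tot v t then 1 else 0)"
      unfolding Z_def tot_eq_pop[OF False] by (intro suminf_le summableI) (auto simp: orphans_def)
    also have "\<dots> \<le> tot v t" by (rule count_below_le[OF ext_nat_tot])
    finally show ?thesis .
  qed simp
  have "(\<integral>\<^sup>+v. Z t v \<partial>?P) \<le> ennreal (c / (1 - ?a))" for t
    using nn_integral_mono[of ?P "Z t" "\<lambda>v. tot v t"] Z_le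
      nn_integral_tot_le[where \<mu>=\<mu> and n=t, OF \<mu> c] by (meson order_trans)
  then have "B \<le> ennreal (c / (1 - ?a))"
    unfolding B_def by (intro SUP_least)
  \<comment> \<open>Finiteness is what turns \<open>B \<le> a B\<close> into \<open>B = 0\<close>:
    for \<open>a > 0\<close> the value \<top> satisfies the inequality too.\<close>
  then have B_fin: "B < \<top>" by (simp add: order_le_less_trans)
  have "(\<integral>\<^sup>+v. Z t v \<partial>?P) \<le> ennreal ?a * B" for t
  proof -
    have "(\<integral>\<^sup>+v. Z t v \<partial>?P) \<le>
        (\<integral>\<^sup>+v. (\<Sum>k. \<Sum>l. if l \<in> orphans v (t - 1 - int k) then of_nat (kids v t k l) else 0) \<partial>?P)"
      using AE_regular[where \<mu>=\<mu>, OF \<mu> c]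
      by (intro nn_integral_mono_AE) (auto simp: Z_def elim!: eventually_mono intro: card_orphans_le)
    also have "\<dots> = (\<Sum>k. \<integral>\<^sup>+v. (\<Sum>l. if l \<in> orphans v (t - 1 - int k) then of_nat (kids v t k l) else 0) \<partial>?P)"
      by (intro nn_integral_suminf) measurable
    also have "\<dots> \<le> (\<Sum>k. ennreal (\<beta> k) * B)"
    proof (intro suminf_le summableI nn_integral_kids)
      fix k
      show "(\<integral>\<^sup>+v. Z (t - 1 - int k) v \<partial>?P) \<le> B"
        unfolding B_def by (rule SUP_upper) simp
      show "(l \<in> orphans (v(Inr (t, k, l) := y)) (t - 1 - int k)) = (l \<in> orphans v (t - 1 - int k))" for l v y
        by (subst orphans_cong[OF agree_upd]) auto
      show "(\<Sum>l. if l \<in> orphans v (t - 1 - int k) then 1 else 0) \<le> Z (t - 1 - int k) v" for v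
        by (simp add: Z_def)
    qed measurable
    also have "\<dots> = ennreal ?a * B"
      by (simp add: suminf_beta)
    finally show ?thesis .
  qed
  then have "B \<le> ennreal ?a * B"
    unfolding B_def by (intro SUP_least)
  then have "B = 0"
  proof -
    obtain b where b: "B = ennreal b" "0 \<le> b" using B_fin by (cases B) auto
    have "b \<le> ?a * b"
      using \<open>B \<le> ennreal ?a * B\<close> b suminf_beta_nonneg by (simp flip: ennreal_mult)
    then have "(1 - ?a) * b \<le> 0" by (simp add: algebra_simps)
    then have "b = 0" using beta_less_1 b(2) by (auto simp: mult_le_0_iff)
    then show ?thesis using b by simp
  qed
  have "AE v in ?P. orphans v t = {}" for t
  proof -
    have "(\<integral>\<^sup>+v. Z t v \<partial>?P) \<le> B" unfolding B_def by (rule SUP_upper) simp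
    then have "(\<integral>\<^sup>+v. Z t v \<partial>?P) = 0" using \<open>B = 0\<close> by simp
    then have "AE v in ?P. Z t v = 0"
      by (subst (asm) nn_integral_0_iff_AE) simp_all
    then show ?thesis
    proof (rule eventually_mono, intro ccontr[of "orphans _ t = {}"])
      fix v assume "Z t v = 0" "orphans v t \<noteq> {}"
      then obtain x where "x \<in> orphans v t" by blast
      then have "1 \<le> Z t v"
        using sum_le_suminf[of "\<lambda>x. if x \<in> orphans v t then 1 else 0 :: ennreal" "{x}"]
        by (simp add: Z_def)
      with \<open>Z t v = 0\<close> show False by simp
    qed
  qed
  then show ?thesis by (simp add: AE_all_countable)
qed

theorem AE_pop_eq_clans:
  assumes \<mu>: "\<And>n. (\<integral>\<^sup>+x. of_nat x \<partial>measure_pmf (\<mu> n)) \<le> ennreal c" and c: "0 \<le> c"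
  shows "AE v in pmf_prod (data_law \<mu> \<beta>). \<forall>n. (of_nat (pop v n) :: ennreal) =
    (\<Sum>\<^sub>\<infinity>i\<in>UNIV. of_nat (\<Sum>j<immi v i. branching coord (n - i) (arr v i j)))"
  using AE_regular[where \<mu>=\<mu>, OF assms] AE_orphans[where \<mu>=\<mu>, OF assms]
  by eventually_elim (simp add: pop_eq_clans)

end

section \<open>Joint laws of independent variables\<close>

lemma indep_vars_reindex:
  assumes "prob_space M" and ind: "prob_space.indep_vars M M' X I" and f: "inj_on f J" "f ` J \<subseteq> I"
  shows "prob_space.indep_vars M (\<lambda>j. M' (f j)) (\<lambda>j. X (f j)) J"
proof -
  interpret prob_space M by fact
  have "indep_vars (\<lambda>j. PiM {f j} M') (\<lambda>j \<omega>. restrict (\<lambda>i. X i \<omega>) {f j}) J"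
    using f by (intro indep_vars_restrict[OF ind]) (auto simp: disjoint_family_on_def inj_on_def)
  then have "indep_vars (\<lambda>j. M' (f j)) (\<lambda>j \<omega>. restrict (\<lambda>i. X i \<omega>) {f j} (f j)) J"
    by (rule indep_vars_compose2) simp
  then show ?thesis by simp
qed

text \<open>Passage between independence with given marginals, the language of the hypotheses, and
  joint product laws, the language of the relabelling.\<close>

lemma distr_eq_pmf_prod_iff:
  assumes "prob_space M" and X: "\<And>q. X q \<in> measurable M nat_space"
  shows "distr M nat_prod (\<lambda>\<omega> q. X q \<omega>) = pmf_prod \<nu> \<longleftrightarrow>
    prob_space.indep_vars M (\<lambda>_. nat_space) X UNIV \<and>
    (\<forall>q. distr M nat_space (X q) = measure_pmf (\<nu> q))"
proof -
  interpret prob_space M by fact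
  have iff: "indep_vars (\<lambda>_. nat_space) X UNIV \<longleftrightarrow>
      distr M nat_prod (\<lambda>\<omega> q. X q \<omega>) = (\<Pi>\<^sub>M q\<in>UNIV. distr M nat_space (X q))"
    using indep_vars_iff_distr_eq_PiM'[of UNIV X "\<lambda>_. nat_space"] X by (simp add: restrict_def)
  show ?thesis
  proof safe
    assume D: "distr M nat_prod (\<lambda>\<omega> q. X q \<omega>) = pmf_prod \<nu>"
    have marg: "distr M nat_space (X q) = measure_pmf (\<nu> q)" for q
    proof -
      have "distr M nat_space (X q) = distr (distr M nat_prod (\<lambda>\<omega> q. X q \<omega>)) nat_space (\<lambda>v. v q)"
        using X by (subst distr_distr) (auto intro!: measurable_nat_prodI simp: comp_def)
      also have "\<dots> = distr (pmf_prod \<nu>) (measure_pmf (\<nu> q)) (\<lambda>v. v q)"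
        unfolding D by (rule distr_cong) auto
      also have "\<dots> = measure_pmf (\<nu> q)"
        by (rule distr_PiM_component) (auto intro: measure_pmf.prob_space_axioms)
      finally show ?thesis .
    qed
    then show "distr M nat_space (X q) = measure_pmf (\<nu> q)" for q .
    show "indep_vars (\<lambda>_. nat_space) X UNIV"
      unfolding iff D marg ..
  next
    assume "indep_vars (\<lambda>_. nat_space) X UNIV" "\<forall>q. distr M nat_space (X q) = measure_pmf (\<nu> q)"
    then show "distr M nat_prod (\<lambda>\<omega> q. X q \<omega>) = pmf_prod \<nu>"
      unfolding iff by simp
  qed
qed

lemma distr_pmf_prod_reindex:
  assumes W: "W \<in> measurable M nat_prod" and D: "distr M nat_prod W = pmf_prod \<nu>" and f: "inj f"
  shows "distr M nat_prod (\<lambda>\<omega> y. W \<omega> (f y)) = pmf_prod (\<lambda>y. \<nu> (f y))"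
proof -
  have "distr M nat_prod (\<lambda>\<omega> y. W \<omega> (f y)) = distr (distr M nat_prod W) nat_prod (\<lambda>v y. v (f y))"
    using W by (subst distr_distr) (auto intro!: measurable_nat_prodI simp: comp_def)
  also have "\<dots> = distr (pmf_prod \<nu>) (pmf_prod (\<lambda>y. \<nu> (f y))) (\<lambda>v. \<lambda>y\<in>UNIV. v (f y))"
    unfolding D by (rule distr_cong) (auto simp: sets_pmf_prod)
  also have "\<dots> = pmf_prod (\<lambda>y. \<nu> (f y))"
    using f by (intro distr_PiM_reindex) (auto intro: measure_pmf.prob_space_axioms)
  finally show ?thesis .
qed

text \<open>Preimages under \<open>f (X \<omega>)\<close> are among the preimages under
  \<open>X\<close>, so independence is inherited. The images under \<open>f\<close> and
  \<open>g\<close> may have different types, which suits the restrictions of one family to two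
  blocks.\<close>

lemma indep_rv_compose:
  assumes "prob_space M" and ind: "prob_space.indep_var M S X T Y"
    and f: "f \<in> measurable S S'" and g: "g \<in> measurable T T'"
  shows "indep_rv M S' (\<lambda>\<omega>. f (X \<omega>)) T' (\<lambda>\<omega>. g (Y \<omega>))"
proof -
  interpret prob_space M by fact
  have X: "X \<in> measurable M S" and Y: "Y \<in> measurable M T"
    using ind by (auto simp: indep_var_eq)
  have fX: "(\<lambda>\<omega>. f (X \<omega>)) \<in> measurable M S'" and gY: "(\<lambda>\<omega>. g (Y \<omega>)) \<in> measurable M T'"
    using X Y f g by simp_all
  have ind': "indep_set (sigma_sets (space M) {X -` A \<inter> space M |A. A \<in> sets S})
      (sigma_sets (space M) {Y -` A \<inter> space M |A. A \<in> sets T})"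
    using ind by (simp add: indep_var_eq)
  have sub: "(\<lambda>\<omega>. h (R \<omega>)) -` A \<inter> space M \<in> sigma_sets (space M) {R -` A \<inter> space M |A. A \<in> sets U}"
    if "R \<in> measurable M U" "h \<in> measurable U U'" "A \<in> sets U'" for R U h U' A
  proof (rule sigma_sets.Basic, rule CollectI, intro exI conjI)
    show "(\<lambda>\<omega>. h (R \<omega>)) -` A \<inter> space M = R -` (h -` A \<inter> space U) \<inter> space M"
      using measurable_space[OF that(1)] by auto
    show "h -` A \<inter> space U \<in> sets U"
      using that by (rule_tac measurable_sets)
  qed
  have "indep_set {(\<lambda>\<omega>. f (X \<omega>)) -` A \<inter> space M | A. A \<in> sets S'}
      {(\<lambda>\<omega>. g (Y \<omega>)) -` B \<inter> space M | B. B \<in> sets T'}"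
  proof (rule indep_setI)
    fix a b
    assume "a \<in> {(\<lambda>\<omega>. f (X \<omega>)) -` A \<inter> space M | A. A \<in> sets S'}"
      and "b \<in> {(\<lambda>\<omega>. g (Y \<omega>)) -` B \<inter> space M | B. B \<in> sets T'}"
    then show "prob (a \<inter> b) = prob a * prob b"
      using sub[OF X f] sub[OF Y g] by (auto intro!: indep_setD[OF ind'])
  qed (use measurable_sets[OF fX] measurable_sets[OF gY] in auto)
  with fX gY show ?thesis by (simp add: indep_rv_def)
qed

lemma distr_Pair_indep_rv:
  assumes "prob_space M" and ind: "indep_rv M S X T Y"
  shows "distr M (S \<Otimes>\<^sub>M T) (\<lambda>\<omega>. (X \<omega>, Y \<omega>)) = distr M S X \<Otimes>\<^sub>M distr M T Y"
proof -
  interpret prob_space M by fact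
  have X: "X \<in> measurable M S" and Y: "Y \<in> measurable M T"
    and ind': "indep_set {X -` A \<inter> space M | A. A \<in> sets S} {Y -` B \<inter> space M | B. B \<in> sets T}"
    using ind by (auto simp: indep_rv_def)
  interpret X: prob_space "distr M S X" by (rule prob_space_distr[OF X])
  interpret Y: prob_space "distr M T Y" by (rule prob_space_distr[OF Y])
  show ?thesis
  proof (rule pair_measure_eqI[symmetric])
    show "sigma_finite_measure (distr M S X)" "sigma_finite_measure (distr M T Y)" ..
    show "sets (distr M S X \<Otimes>\<^sub>M distr M T Y) = sets (distr M (S \<Otimes>\<^sub>M T) (\<lambda>\<omega>. (X \<omega>, Y \<omega>)))"
      by (simp cong: sets_pair_measure_cong)
    fix A B assume "A \<in> sets (distr M S X)" "B \<in> sets (distr M T Y)"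
    then have A: "A \<in> sets S" and B: "B \<in> sets T" by auto
    have "(\<lambda>\<omega>. (X \<omega>, Y \<omega>)) -` (A \<times> B) \<inter> space M = (X -` A \<inter> space M) \<inter> (Y -` B \<inter> space M)"
      by auto
    moreover have "prob ((X -` A \<inter> space M) \<inter> (Y -` B \<inter> space M))
        = prob (X -` A \<inter> space M) * prob (Y -` B \<inter> space M)"
      using A B by (intro indep_setD[OF ind']) auto
    ultimately show "emeasure (distr M S X) A * emeasure (distr M T Y) B
        = emeasure (distr M (S \<Otimes>\<^sub>M T) (\<lambda>\<omega>. (X \<omega>, Y \<omega>))) (A \<times> B)"
      using A B X Y
      by (simp add: emeasure_distr emeasure_eq_measure ennreal_mult)
  qed
qed

section \<open>The cluster representation\<close>

lemma measurable_generation_coord [measurable]: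
  "(\<lambda>z. generation coord g n z) \<in> measurable nat_prod nat_space"
proof (induction g arbitrary: n)
  case (Suc g)
  have [measurable]: "(\<lambda>z. \<Sum>m<generation coord g (n - 1 - int k) z. z (n, k, g, m))
      \<in> measurable nat_prod nat_space" for k
    by (rule measurable_random_sum[OF _ Suc.IH]) simp
  show ?case unfolding generation_coord_Suc by measurable
next
  case 0
  have "(\<lambda>z. generation coord 0 n z) = (\<lambda>z. if n = 0 then 1 else 0)" by auto
  then show ?case by simp
qed

lemma measurable_branching_coord:
  "(\<lambda>z n. branching coord n z) \<in> measurable nat_prod path_space"
  unfolding path_space_def branching_eq by (intro measurable_nat_prodI) measurable

lemma branching_neg: "n < 0 \<Longrightarrow> branching \<zeta> n \<omega> = 0"
  by (simp add: branching_eq)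

definition offspring_law :: "(nat \<Rightarrow> real) \<Rightarrow> int \<times> nat \<times> nat \<times> nat \<Rightarrow> nat pmf" where
  "offspring_law \<beta> y = (case y of (_, k, _, _) \<Rightarrow> pois (\<beta> k))"

text \<open>The immigration law may vary with time under a uniform bound on means: it will be
  Poisson, a point mass, or the law of the children of the ancestor. The last conjunct holds at
  every sample point and later cuts the series off at immigration times up to
  \<open>n\<close>.\<close>

theorem (in subcritical) ex_clusters:
  fixes M :: "'a measure" and N :: "'b measure"
  assumes M: "prob_space M" and V: "V \<in> measurable M nat_prod"
    and law: "distr M nat_prod V = pmf_prod (data_law \<mu> \<beta>)"
    and \<mu>: "\<And>n. (\<integral>\<^sup>+x. of_nat x \<partial>measure_pmf (\<mu> n)) \<le> ennreal c" and c: "0 \<le> c"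
    and Z: "Z \<in> measurable N nat_prod" and Z_law: "distr N nat_prod Z = pmf_prod (offspring_law \<beta>)"
  shows "\<exists>C. indep_copies M C N (\<lambda>n \<omega>. branching coord n (Z \<omega>)) \<and>
    family_indep_of M C (\<lambda>n \<omega>. immi (V \<omega>) n) \<and>
    (AE \<omega> in M. \<forall>n. (of_nat (pop (V \<omega>) n) :: ennreal) =
      (\<Sum>\<^sub>\<infinity>i\<in>UNIV. of_nat (\<Sum>j=1..immi (V \<omega>) i. C i j (n - i) \<omega>))) \<and>
    (\<forall>i j n \<omega>. n < 0 \<longrightarrow> C i j n \<omega> = 0)"
proof -
  interpret prob_space M by fact
  define C where "C i j n \<omega> = branching coord n (arr (V \<omega>) i (j - 1))" for i j n \<omega>
  define W where "W \<omega> q = V \<omega> (sel q (V \<omega>))" for \<omega> q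
  have CW: "C i j n \<omega> = branching coord n (\<lambda>y. W \<omega> (Inr ((i, j - 1), y)))" for i j n \<omega>
    by (simp add: C_def W_def arr_def)
  have W: "W \<in> measurable M nat_prod"
    unfolding W_def using measurable_compose[OF V distr_sel(1)] .
  have W_law: "distr M nat_prod W = pmf_prod (cluster_law \<mu> \<beta>)"
  proof -
    have "distr M nat_prod W = distr (distr M nat_prod V) nat_prod (\<lambda>v q. v (sel q v))"
      using V distr_sel(1) by (subst distr_distr) (auto simp: W_def[abs_def] comp_def)
    then show ?thesis by (simp add: law distr_sel(2))
  qed
  have Wq: "(\<lambda>\<omega>. W \<omega> q) \<in> measurable M nat_space" for q
    using measurable_compose[OF W measurable_from_nat_prod] .
  have ind: "indep_vars (\<lambda>_. nat_space) (\<lambda>q \<omega>. W \<omega> q) UNIV"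
    using distr_eq_pmf_prod_iff[OF M, of "\<lambda>q \<omega>. W \<omega> q"] Wq W_law by auto
  have comp: "(\<lambda>w n. branching coord n (\<lambda>y. w (Inr (p, y)))) \<in> measurable (PiM K (\<lambda>_. nat_space)) path_space"
    if "range (\<lambda>y. Inr (p, y)) \<subseteq> K" for p and K :: "(int + (int \<times> nat) \<times> int \<times> nat \<times> nat \<times> nat) set"
  proof (rule measurable_compose[OF _ measurable_branching_coord])
    show "(\<lambda>w y. w (Inr (p, y))) \<in> measurable (PiM K (\<lambda>_. nat_space)) nat_prod"
      using that by (intro measurable_nat_prodI measurable_component_singleton) auto
  qed
  have copies: "indep_copies M C N (\<lambda>n \<omega>. branching coord n (Z \<omega>))"
    unfolding indep_copies_def
  proof (intro conjI allI impI)
    \<comment> \<open>Copy \<open>(i, j)\<close> reads only the block of clan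
      \<open>(i, j - 1)\<close>; for \<open>j \<ge> 1\<close> the shift is injective, so the blocks
      are disjoint.\<close>
    let ?K = "\<lambda>p :: int \<times> nat. range (\<lambda>y :: int \<times> nat \<times> nat \<times> nat. Inr ((fst p, snd p - 1), y)) :: (int + _) set"
    have "indep_vars (\<lambda>p. PiM (?K p) (\<lambda>_. nat_space)) (\<lambda>p \<omega>. restrict (W \<omega>) (?K p)) (UNIV \<times> {1..})"
      by (rule indep_vars_restrict[OF ind]) (auto simp: disjoint_family_on_def)
    then have "indep_vars (\<lambda>_. path_space)
        (\<lambda>p \<omega> n. branching coord n (\<lambda>y. restrict (W \<omega>) (?K p) (Inr ((fst p, snd p - 1), y)))) (UNIV \<times> {1..})"
      by (rule indep_vars_compose2) (rule comp, simp)
    then show "indep_vars (\<lambda>_. path_space) (\<lambda>(i, j) \<omega> n. C i j n \<omega>) (UNIV \<times> {1..})"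
      by (simp add: CW case_prod_beta')
    fix i :: int and j :: nat
    have "distr M path_space (\<lambda>\<omega> n. C i j n \<omega>)
        = distr (distr M nat_prod (\<lambda>\<omega> y. W \<omega> (Inr ((i, j - 1), y)))) path_space (\<lambda>z n. branching coord n z)"
      using Wq by (subst distr_distr) (auto intro!: measurable_nat_prodI measurable_branching_coord simp: comp_def CW)
    also have "distr M nat_prod (\<lambda>\<omega> y. W \<omega> (Inr ((i, j - 1), y))) = pmf_prod (\<lambda>y. cluster_law \<mu> \<beta> (Inr ((i, j - 1), y)))"
      by (rule distr_pmf_prod_reindex[OF W W_law]) (auto intro: injI)
    also have "(\<lambda>y. cluster_law \<mu> \<beta> (Inr ((i, j - 1), y))) = offspring_law \<beta>"
      by (auto simp: cluster_law_def offspring_law_def)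
    also have "distr (pmf_prod (offspring_law \<beta>)) path_space (\<lambda>z n. branching coord n z)
        = distr N path_space (\<lambda>\<omega> n. branching coord n (Z \<omega>))"
      unfolding Z_law[symmetric] using Z
      by (subst distr_distr) (auto intro!: measurable_branching_coord simp: comp_def)
    finally show "distr M path_space (\<lambda>\<omega> n. C i j n \<omega>) = distr N path_space (\<lambda>\<omega> n. branching coord n (Z \<omega>))" .
  qed
  have fam: "family_indep_of M C (\<lambda>n \<omega>. immi (V \<omega>) n)"
    unfolding family_indep_of_def
  proof -
    let ?A = "range Inr :: (int + (int \<times> nat) \<times> int \<times> nat \<times> nat \<times> nat) set"
    let ?B = "range Inl :: (int + (int \<times> nat) \<times> int \<times> nat \<times> nat \<times> nat) set"
    \<comment> \<open>Immigration and clans occupy complementary coordinates of the relabelled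
      family.\<close>
    have iv: "indep_var (PiM ?A (\<lambda>_. nat_space)) (\<lambda>\<omega>. restrict (W \<omega>) ?A)
        (PiM ?B (\<lambda>_. nat_space)) (\<lambda>\<omega>. restrict (W \<omega>) ?B)"
      by (rule indep_var_restrict[OF ind]) auto
    define f :: "(int + (int \<times> nat) \<times> int \<times> nat \<times> nat \<times> nat \<Rightarrow> nat) \<Rightarrow> int \<times> nat \<Rightarrow> int \<Rightarrow> nat"
      where "f w = (\<lambda>(i, j)\<in>UNIV \<times> {1..}. \<lambda>n. branching coord n (\<lambda>y. w (Inr ((i, j - 1), y))))" for w
    define g :: "(int + (int \<times> nat) \<times> int \<times> nat \<times> nat \<times> nat \<Rightarrow> nat) \<Rightarrow> int \<Rightarrow> nat"
      where "g w n = w (Inl n)" for w n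
    have f: "f \<in> measurable (PiM ?A (\<lambda>_. nat_space)) (\<Pi>\<^sub>M p\<in>UNIV \<times> {1..}. path_space)"
      unfolding f_def by (rule measurable_restrict) (auto intro!: comp)
    have g: "g \<in> measurable (PiM ?B (\<lambda>_. nat_space)) path_space"
      unfolding g_def path_space_def by (intro measurable_nat_prodI measurable_component_singleton) auto
    have "indep_rv M (\<Pi>\<^sub>M p\<in>UNIV \<times> {1..}. path_space) (\<lambda>\<omega>. f (restrict (W \<omega>) ?A))
        path_space (\<lambda>\<omega>. g (restrict (W \<omega>) ?B))"
      by (rule indep_rv_compose[OF M iv f g])
    moreover have "f (restrict (W \<omega>) ?A) = (\<lambda>(i, j)\<in>UNIV \<times> {1..}. \<lambda>n. C i j n \<omega>)" for \<omega>
      by (simp add: f_def CW)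
    moreover have "g (restrict (W \<omega>) ?B) = (\<lambda>n. immi (V \<omega>) n)" for \<omega>
      by (simp add: g_def W_def fun_eq_iff)
    ultimately show "indep_rv M (\<Pi>\<^sub>M p\<in>UNIV \<times> {1..}. path_space)
        (\<lambda>\<omega>. \<lambda>(i, j)\<in>UNIV \<times> {1..}. \<lambda>n. C i j n \<omega>) path_space (\<lambda>\<omega> n. immi (V \<omega>) n)"
      by simp
  qed
  have "AE v in distr M nat_prod V. \<forall>n. (of_nat (pop v n) :: ennreal) =
      (\<Sum>\<^sub>\<infinity>i\<in>UNIV. of_nat (\<Sum>j<immi v i. branching coord (n - i) (arr v i j)))"
    unfolding law by (rule AE_pop_eq_clans[OF \<mu> c])
  then have "AE \<omega> in M. \<forall>n. (of_nat (pop (V \<omega>) n) :: ennreal) =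
      (\<Sum>\<^sub>\<infinity>i\<in>UNIV. of_nat (\<Sum>j<immi (V \<omega>) i. branching coord (n - i) (arr (V \<omega>) i j)))"
    by (rule AE_distrD[OF V])
  then have "AE \<omega> in M. \<forall>n. (of_nat (pop (V \<omega>) n) :: ennreal) =
      (\<Sum>\<^sub>\<infinity>i\<in>UNIV. of_nat (\<Sum>j=1..immi (V \<omega>) i. C i j (n - i) \<omega>))"
    by (simp add: C_def sum.atLeast1_atMost_eq)
  with copies fam show ?thesis
    by (intro exI[of _ C]) (simp add: C_def branching_neg)
qed

lemma AE_regular_distr:
  assumes "subcritical \<beta>" and V: "V \<in> measurable M nat_prod"
    and law: "distr M nat_prod V = pmf_prod (data_law \<mu> \<beta>)"
    and \<mu>: "\<And>n. (\<integral>\<^sup>+x. of_nat x \<partial>measure_pmf (\<mu> n)) \<le> ennreal c" and c: "0 \<le> c"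
  shows "AE \<omega> in M. regular (V \<omega>)"
  using subcritical.AE_regular[OF assms(1), where \<mu>=\<mu>, OF \<mu> c] AE_distrD[OF V] unfolding law[symmetric]
  by blast

section \<open>The branching process as an INAR process with one immigrant\<close>

text \<open>Removing the ancestor at time 0 and declaring its children to be immigrants. Since all immigrants
  of the new process arrive after time 0, the coordinates of the children of individuals at time 0
  play no role in it; they are replaced by unused ones. The coordinates \<open>Inl n\<close> with \<open>n < 0\<close>, which
  vanish almost surely, serve to set the new immigration up to time 0 to 0.\<close>

definition shed_index :: "int + int \<times> nat \<times> nat \<Rightarrow> int + int \<times> nat \<times> nat" where
  "shed_index b = (case b of
     Inl n \<Rightarrow> if 1 \<le> n then Inr (n, nat n - 1, 0) else Inl (n - 1)
   | Inr (n, k, l) \<Rightarrow> Inr (n, k, if n - 1 - int k = 0 then Suc l else l))"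

definition shed :: "inar_data \<Rightarrow> inar_data" where
  "shed v b = v (shed_index b)"

lemma inj_shed_index: "inj shed_index"
  by (rule injI) (auto simp: shed_index_def split: sum.splits prod.splits if_splits)

lemma shed_simps:
  "immi (shed v) n = (if 1 \<le> n then kids v n (nat n - 1) 0 else immi v (n - 1))"
  "kids (shed v) n k l = kids v n k (if n - 1 - int k = 0 then Suc l else l)"
  by (simp_all add: shed_def shed_index_def)

lemma approx_shed_nonpos:
  assumes "\<And>n. n < 0 \<Longrightarrow> immi v n = 0"
  shows "n \<le> 0 \<Longrightarrow> approx r (shed v) n = 0"
proof (induction r arbitrary: n)
  case (Suc r)
  then have "approx r (shed v) (n - 1 - int k) = 0" for k
    by (intro Suc.IH) simp
  then show ?case using Suc.prems assms by (simp add: shed_simps(1))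
qed simp

text \<open>The ancestor itself takes up the first round, whence the shift by one. Its children move
  from the offspring sum into the immigration.\<close>

lemma approx_shed:
  assumes immi: "\<And>n. immi v n = (if n = 0 then 1 else 0)"
  shows "approx (Suc r) v n = (if n = 0 then 1 else 0) + approx r (shed v) n"
proof (induction r arbitrary: n)
  case 0
  show ?case by (simp add: immi)
next
  case (Suc r)
  \<comment> \<open>The contribution of the ancestor, which has label 0 at time 0; it is nonzero for
    at most one lag.\<close>
  define d where "d k = (if n - 1 - int k = 0 then of_nat (kids v n k 0) else 0 :: ennreal)" for k
  have shed0: "approx r (shed v) 0 = 0"
    by (rule approx_shed_nonpos) (simp_all add: immi)
  have inner: "(\<Sum>l. if of_nat l < approx (Suc r) v (n - 1 - int k) then of_nat (kids v n k l) else 0)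
      = d k + (\<Sum>l. if of_nat l < approx r (shed v) (n - 1 - int k) then of_nat (kids (shed v) n k l) else 0)"
    for k
  proof (cases "n - 1 - int k = 0")
    case True
    \<comment> \<open>Only the ancestor lives at time 0, because the shed process is still empty
      then.\<close>
    have "approx (Suc r) v (n - 1 - int k) = of_nat 1"
      using Suc.IH[of "n - 1 - int k"] shed0 True by simp
    then have "(\<Sum>l. if of_nat l < approx (Suc r) v (n - 1 - int k) then of_nat (kids v n k l) else 0)
        = (\<Sum>l. if l < 1 then of_nat (kids v n k l) else 0 :: ennreal)"
      by (simp only: of_nat_less_iff)
    also have "\<dots> = (\<Sum>l\<in>{0}. if l < 1 then of_nat (kids v n k l) else 0)"
      by (rule suminf_finite) auto
    finally show ?thesis using True shed0 by (simp add: d_def)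
  next
    case False
    then show ?thesis
      using Suc.IH[of "n - 1 - int k"] by (simp add: d_def shed_simps(2) del: approx.simps cong: if_cong)
  qed
  have d_sum: "(\<Sum>k. d k) = of_nat (immi (shed v) n)"
  proof (cases "1 \<le> n")
    case True
    have "(\<Sum>k. d k) = (\<Sum>k\<in>{nat n - 1}. d k)"
      using True by (intro suminf_finite) (auto simp: d_def)
    then show ?thesis using True by (simp add: d_def shed_simps(1) of_nat_diff)
  next
    case False
    then have "d k = 0" for k by (simp add: d_def)
    then show ?thesis using False by (simp add: shed_simps(1) immi)
  qed
  have "approx (Suc (Suc r)) v n = of_nat (immi v n) +
      (\<Sum>k. d k + (\<Sum>l. if of_nat l < approx r (shed v) (n - 1 - int k) then of_nat (kids (shed v) n k l) else 0))"
    by (subst approx.simps(2)) (simp only: inner)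
  also have "\<dots> = of_nat (immi v n) + (of_nat (immi (shed v) n) +
      (\<Sum>k. \<Sum>l. if of_nat l < approx r (shed v) (n - 1 - int k) then of_nat (kids (shed v) n k l) else 0))"
    by (subst suminf_add[OF summableI summableI, symmetric]) (simp only: d_sum)
  also have "\<dots> = (if n = 0 then 1 else 0) + approx (Suc r) (shed v) n"
    by (simp add: immi)
  finally show ?case .
qed

lemma tot_shed:
  assumes "\<And>n. immi v n = (if n = 0 then 1 else 0)"
  shows "tot v n = (if n = 0 then 1 else 0) + tot (shed v) n"
proof -
  have "tot v n = (SUP r. approx (Suc r) v n)"
    by (rule tot_eq_SUP_Suc)
  also have "\<dots> = (if n = 0 then 1 else 0) + tot (shed v) n"
    unfolding approx_shed[OF assms] tot_def by (simp add: ennreal_SUP_add_right)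
  finally show ?thesis .
qed

lemma pop_shed:
  assumes "\<And>n. immi v n = (if n = 0 then 1 else 0)" and v: "regular v"
  shows "pop v n = (if n = 0 then 1 else 0) + pop (shed v) n"
proof -
  have "regular (shed v)"
    using v tot_shed[OF assms(1)] unfolding regular_def by (metis ennreal_add_eq_top)
  then have "(of_nat (pop v n) :: ennreal) = of_nat ((if n = 0 then 1 else 0) + pop (shed v) n)"
    using tot_shed[OF assms(1), of n] regular_tot v by simp
  then show ?thesis by (simp only: of_nat_eq_iff)
qed

section \<open>Uniqueness of the law of the superposition\<close>

abbreviation superposition ::
  "(int \<Rightarrow> nat) \<Rightarrow> (int \<times> nat \<Rightarrow> int \<Rightarrow> nat) \<Rightarrow> int \<Rightarrow> nat" where
  "superposition h c n \<equiv> (if n = 0 then 1 else 0) + (\<Sum>i=1..n. \<Sum>j=1..h i. c (i, j) (n - i))"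

lemma measurable_superposition:
  "(\<lambda>(h, c) n. superposition h c n)
    \<in> measurable (path_space \<Otimes>\<^sub>M (\<Pi>\<^sub>M p\<in>UNIV \<times> {1..}. path_space)) path_space"
  (is "_ \<in> measurable ?S path_space")
proof -
  have h: "(\<lambda>x. fst x i) \<in> measurable ?S nat_space" for i
    unfolding path_space_def by measurable
  have c: "(\<lambda>x. snd x (i, Suc j) m) \<in> measurable ?S nat_space" for i j m
  proof -
    have "(\<lambda>x. snd x (i, Suc j)) \<in> measurable ?S path_space"
      by (rule measurable_compose[OF measurable_snd measurable_component_singleton]) auto
    moreover have "(\<lambda>p. p m) \<in> measurable path_space nat_space"
      unfolding path_space_def by simp
    ultimately show ?thesis by (rule measurable_compose)
  qed
  have [measurable]: "(\<lambda>x. \<Sum>j=1..fst x i. snd x (i, j) (n - i)) \<in> measurable ?S nat_space" for i n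
  proof -
    have "(\<lambda>x. \<Sum>j<fst x i. snd x (i, Suc j) (n - i)) \<in> measurable ?S nat_space"
      by (rule measurable_random_sum(1)[OF c h])
    then show ?thesis by (simp add: sum.atLeast1_atMost_eq)
  qed
  have "(\<lambda>x n. superposition (fst x) (snd x) n) \<in> measurable ?S path_space"
    by (subst (2) path_space_def) (intro measurable_nat_prodI, measurable)
  then show ?thesis by (simp add: split_beta')
qed

lemma indep_rv_sym:
  assumes "prob_space M" "indep_rv M S X T Y"
  shows "indep_rv M T Y S X"
proof -
  interpret prob_space M by fact
  have ind: "indep_set {X -` A \<inter> space M | A. A \<in> sets S} {Y -` B \<inter> space M | B. B \<in> sets T}"
    using assms(2) by (simp add: indep_rv_def)
  have "indep_set {Y -` B \<inter> space M | B. B \<in> sets T} {X -` A \<inter> space M | A. A \<in> sets S}"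
  proof (rule indep_setI)
    fix b a assume "b \<in> {Y -` B \<inter> space M | B. B \<in> sets T}" "a \<in> {X -` A \<inter> space M | A. A \<in> sets S}"
    then show "prob (b \<inter> a) = prob b * prob a"
      using indep_setD[OF ind, of a b] by (simp add: Int_commute mult.commute)
  qed (use indep_setD_ev1[OF ind] indep_setD_ev2[OF ind] in auto)
  then show ?thesis using assms(2) by (simp add: indep_rv_def)
qed

text \<open>Independence makes the joint law of \<open>H\<close> and the family a product, so the
  law depends only on those of \<open>H\<close> and \<open>F\<close>. One convenient realisation
  therefore decides the distributional equality for all of them.\<close>

lemma distr_superposition:
  assumes M: "prob_space M" and copies: "indep_copies M C N F" and fam: "family_indep_of M C H"
  shows "(\<lambda>\<omega> n. superposition (\<lambda>i. H i \<omega>) (\<lambda>(i, j) m. C i j m \<omega>) n) \<in> measurable M path_space"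
    and "distr M path_space (\<lambda>\<omega> n. superposition (\<lambda>i. H i \<omega>) (\<lambda>(i, j) m. C i j m \<omega>) n) =
    distr (distr M path_space (\<lambda>\<omega> n. H n \<omega>) \<Otimes>\<^sub>M
        (\<Pi>\<^sub>M p\<in>UNIV \<times> {1..}. distr N path_space (\<lambda>\<omega> n. F n \<omega>)))
      path_space (\<lambda>(h, c) n. superposition h c n)"
proof -
  interpret prob_space M by fact
  let ?I = "UNIV \<times> {1..} :: (int \<times> nat) set"
  let ?X = "\<lambda>\<omega>. \<lambda>(i, j)\<in>?I. \<lambda>n. C i j n \<omega>"
  let ?PI = "\<Pi>\<^sub>M p\<in>?I. path_space"
  have ind: "indep_vars (\<lambda>_. path_space) (\<lambda>(i, j) \<omega> n. C i j n \<omega>) ?I"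
    and law: "\<And>i j. j \<ge> 1 \<Longrightarrow> distr M path_space (\<lambda>\<omega> n. C i j n \<omega>) = distr N path_space (\<lambda>\<omega> n. F n \<omega>)"
    using copies by (auto simp: indep_copies_def)
  have rv: "p \<in> ?I \<Longrightarrow> (case p of (i, j) \<Rightarrow> \<lambda>\<omega> n. C i j n \<omega>) \<in> measurable M path_space" for p
    using ind unfolding indep_vars_def by blast
  have X_law: "distr M ?PI ?X = (\<Pi>\<^sub>M p\<in>?I. distr N path_space (\<lambda>\<omega> n. F n \<omega>))"
  proof -
    have "?X = (\<lambda>\<omega>. \<lambda>p\<in>?I. (case p of (i, j) \<Rightarrow> \<lambda>\<omega> n. C i j n \<omega>) \<omega>)"
      by (auto simp: fun_eq_iff restrict_def)
    then have "distr M ?PI ?X = (\<Pi>\<^sub>M p\<in>?I. distr M path_space (case p of (i, j) \<Rightarrow> \<lambda>\<omega> n. C i j n \<omega>))"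
      using indep_vars_iff_distr_eq_PiM'[of ?I "\<lambda>(i, j) \<omega> n. C i j n \<omega>" "\<lambda>_. path_space"] rv ind
      by fastforce
    also have "\<dots> = (\<Pi>\<^sub>M p\<in>?I. distr N path_space (\<lambda>\<omega> n. F n \<omega>))"
      using law by (intro PiM_cong) auto
    finally show ?thesis .
  qed
  have irv: "indep_rv M path_space (\<lambda>\<omega> n. H n \<omega>) ?PI ?X"
    by (rule indep_rv_sym[OF M]) (use fam in \<open>simp add: family_indep_of_def\<close>)
  then have HX: "(\<lambda>\<omega>. (\<lambda>n. H n \<omega>, ?X \<omega>)) \<in> measurable M (path_space \<Otimes>\<^sub>M ?PI)"
    unfolding indep_rv_def by (intro measurable_Pair) auto
  \<comment> \<open>Only indices \<open>j \<ge> 1\<close> occur, so the restricted family gives the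
    same sum.\<close>
  have sup: "superposition (\<lambda>i. H i \<omega>) (\<lambda>(i, j) m. C i j m \<omega>) n = superposition (\<lambda>i. H i \<omega>) (?X \<omega>) n" for \<omega> n
    by (auto intro!: sum.cong)
  have comp: "(\<lambda>\<omega> n. superposition (\<lambda>i. H i \<omega>) (\<lambda>(i, j) m. C i j m \<omega>) n)
      = (\<lambda>(h, c) n. superposition h c n) \<circ> (\<lambda>\<omega>. (\<lambda>n. H n \<omega>, ?X \<omega>))"
    unfolding sup by (simp add: comp_def)
  show "(\<lambda>\<omega> n. superposition (\<lambda>i. H i \<omega>) (\<lambda>(i, j) m. C i j m \<omega>) n) \<in> measurable M path_space"
    unfolding comp by (rule measurable_comp[OF HX measurable_superposition])
  have "distr M path_space (\<lambda>\<omega> n. superposition (\<lambda>i. H i \<omega>) (\<lambda>(i, j) m. C i j m \<omega>) n)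
      = distr (distr M (path_space \<Otimes>\<^sub>M ?PI) (\<lambda>\<omega>. (\<lambda>n. H n \<omega>, ?X \<omega>))) path_space (\<lambda>(h, c) n. superposition h c n)"
    unfolding comp by (rule distr_distr[OF measurable_superposition HX, symmetric])
  also have "distr M (path_space \<Otimes>\<^sub>M ?PI) (\<lambda>\<omega>. (\<lambda>n. H n \<omega>, ?X \<omega>))
      = distr M path_space (\<lambda>\<omega> n. H n \<omega>) \<Otimes>\<^sub>M (\<Pi>\<^sub>M p\<in>?I. distr N path_space (\<lambda>\<omega> n. F n \<omega>))"
    unfolding distr_Pair_indep_rv[OF M irv] X_law ..
  finally show "distr M path_space (\<lambda>\<omega> n. superposition (\<lambda>i. H i \<omega>) (\<lambda>(i, j) m. C i j m \<omega>) n) =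
    distr (distr M path_space (\<lambda>\<omega> n. H n \<omega>) \<Otimes>\<^sub>M
        (\<Pi>\<^sub>M p\<in>?I. distr N path_space (\<lambda>\<omega> n. F n \<omega>)))
      path_space (\<lambda>(h, c) n. superposition h c n)" .
qed

definition child_law :: "(nat \<Rightarrow> real) \<Rightarrow> int \<Rightarrow> nat pmf" where
  "child_law \<beta> n = (if 1 \<le> n then pois (\<beta> (nat n - 1)) else return_pmf 0)"

text \<open>Only lag \<open>n\<close>, with index \<open>nat n - 1\<close>, leads back to the
  ancestor at time 0, and the ancestor is the sole member there.\<close>

lemma generation_coord_1:
  "generation coord 1 n z = (if 1 \<le> n then z (n, nat n - 1, 0, 0) else 0)"
proof -
  have "generation coord 1 n z = (\<Sum>k<nat n. if k = nat n - 1 then z (n, k, 0, 0) else 0)"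
    unfolding One_nat_def generation_coord_Suc
    by (intro sum.cong refl) auto
  also have "\<dots> = (if 1 \<le> n then z (n, nat n - 1, 0, 0) else 0)"
    by auto
  finally show ?thesis .
qed

text \<open>Different times read different coordinates of the array, and the values before time 1
  are constant.\<close>

lemma distr_generation_1:
  assumes N: "prob_space N" and Z: "Z \<in> measurable N nat_prod"
    and law: "distr N nat_prod Z = pmf_prod (offspring_law \<beta>)"
  shows "distr N nat_prod (\<lambda>\<omega> n. generation coord 1 n (Z \<omega>)) = pmf_prod (child_law \<beta>)"
proof -
  interpret prob_space N by fact
  have gm: "(\<lambda>\<omega>. generation coord 1 n (Z \<omega>)) \<in> measurable N nat_space" for n
    by (rule measurable_compose[OF Z measurable_generation_coord])
  have Zq: "(\<lambda>\<omega>. Z \<omega> q) \<in> measurable N nat_space" for q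
    using measurable_compose[OF Z measurable_from_nat_prod] .
  let ?q = "\<lambda>n :: int. (n, nat n - 1, 0 :: nat, 0 :: nat)"
  have "distr N nat_prod (\<lambda>\<omega> n. Z \<omega> (?q n)) = pmf_prod (\<lambda>n. offspring_law \<beta> (?q n))"
    by (rule distr_pmf_prod_reindex[OF Z law]) (auto intro: injI)
  then have ind: "indep_vars (\<lambda>_. nat_space) (\<lambda>n \<omega>. Z \<omega> (?q n)) UNIV"
    and marg: "\<And>n. distr N nat_space (\<lambda>\<omega>. Z \<omega> (?q n)) = measure_pmf (offspring_law \<beta> (?q n))"
    using distr_eq_pmf_prod_iff[of N "\<lambda>n \<omega>. Z \<omega> (?q n)" "\<lambda>n. offspring_law \<beta> (?q n)", OF N Zq]
    by simp_all
  have "indep_vars (\<lambda>_. nat_space) (\<lambda>n \<omega>. (\<lambda>x. if 1 \<le> n then x else 0) (Z \<omega> (?q n))) UNIV"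
    by (rule indep_vars_compose2[OF ind]) simp
  moreover have "distr N nat_space (\<lambda>\<omega>. generation coord 1 n (Z \<omega>)) = measure_pmf (child_law \<beta> n)" for n
  proof (cases "1 \<le> n")
    case True
    then show ?thesis
      using marg[of n] unfolding generation_coord_1 by (simp add: child_law_def offspring_law_def)
  next
    case False
    then have "distr N nat_space (\<lambda>\<omega>. generation coord 1 n (Z \<omega>)) = return nat_space 0"
      unfolding generation_coord_1 by (simp add: distr_const)
    then show ?thesis using False by (simp add: child_law_def return_pmf.rep_eq)
  qed
  ultimately show ?thesis
    using distr_eq_pmf_prod_iff[of N "\<lambda>n \<omega>. generation coord 1 n (Z \<omega>)" "child_law \<beta>", OF N gm] unfolding generation_coord_1 by simp
qed

context subcritical
begin

lemma beta_le_1: "\<beta> k \<le> 1"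
  using sum_le_suminf[OF beta_summable, of "{k}"] beta_nonneg beta_less_1 by simp

text \<open>Both sides are the law of the same path \<open>pop v\<close> under one measure
  \<open>P\<close>, decomposed into the clusters of \<open>v\<close> and into those of
  \<open>shed v\<close>. No coupling of \<open>N\<close> and \<open>K\<close> is needed, since
  \<open>distr_superposition\<close> carries the second description over to
  \<open>K\<close>.\<close>

theorem distr_branching_eq_superposition:
  fixes N :: "'b measure" and K :: "'c measure"
  assumes N: "prob_space N" and Z: "Z \<in> measurable N nat_prod"
    and Z_law: "distr N nat_prod Z = pmf_prod (offspring_law \<beta>)"
    and K: "prob_space K"
    and H: "distr K path_space (\<lambda>\<omega> n. H n \<omega>) = distr N path_space (\<lambda>\<omega> n. generation coord 1 n (Z \<omega>))"
    and copies: "indep_copies K C N (\<lambda>n \<omega>. branching coord n (Z \<omega>))"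
    and fam: "family_indep_of K C H"
  shows "distr N path_space (\<lambda>\<omega> n. branching coord n (Z \<omega>)) =
    distr K path_space (\<lambda>\<omega> n. superposition (\<lambda>i. H i \<omega>) (\<lambda>(i, j) m. C i j m \<omega>) n)"
proof -
  \<comment> \<open>The deterministic immigrant enters the product law as a point mass, so the
    cluster theorem applies unchanged.\<close>
  define \<delta> :: "int \<Rightarrow> nat pmf" where "\<delta> n = return_pmf (if n = 0 then 1 else 0)" for n
  define P where "P = pmf_prod (data_law \<delta> \<beta>)"
  have P: "prob_space P" unfolding P_def by (rule prob_space_pmf_prod)
  have id: "(\<lambda>v. v) \<in> measurable P nat_prod" "distr P nat_prod (\<lambda>v. v) = pmf_prod (data_law \<delta> \<beta>)"
    by (auto simp: P_def sets_pmf_prod intro!: distr_id2)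
  have \<delta>_mean: "(\<integral>\<^sup>+x. of_nat x \<partial>measure_pmf (\<delta> n)) \<le> ennreal 1" for n
    by (simp add: \<delta>_def)
  have pop_m: "(\<lambda>v n. pop v n) \<in> measurable P path_space"
    unfolding path_space_def P_def by (intro measurable_nat_prodI) measurable
  have immi_AE: "AE v in P. \<forall>n. immi v n = (if n = 0 then 1 else 0)"
    unfolding AE_all_countable
  proof
    fix n
    have "AE x in measure_pmf (data_law \<delta> \<beta> (Inl n)). x = (if n = 0 then 1 else 0)"
      by (simp add: \<delta>_def AE_measure_pmf_iff)
    then show "AE v in P. immi v n = (if n = 0 then 1 else 0)"
      unfolding P_def by (rule AE_PiM_component[rotated 2]) (auto intro: measure_pmf.prob_space_axioms)
  qed
  have reg: "AE v in P. regular v"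
    unfolding P_def by (rule AE_regular[OF \<delta>_mean]) simp
  obtain C1 where C1: "indep_copies P C1 N (\<lambda>n \<omega>. branching coord n (Z \<omega>))"
    and C1_AE: "AE v in P. \<forall>n. (of_nat (pop v n) :: ennreal) =
      (\<Sum>\<^sub>\<infinity>i\<in>UNIV. of_nat (\<Sum>j=1..immi v i. C1 i j (n - i) v))"
    using ex_clusters[OF P id \<delta>_mean _ Z Z_law] by auto
  have "AE v in P. \<forall>n. pop v n = C1 0 1 n v"
    using C1_AE immi_AE
  proof (eventually_elim, intro allI)
    fix v n
    assume pop: "\<forall>n. (of_nat (pop v n) :: ennreal) = (\<Sum>\<^sub>\<infinity>i\<in>UNIV. of_nat (\<Sum>j=1..immi v i. C1 i j (n - i) v))"
      and immi: "\<forall>n. immi v n = (if n = 0 then 1 else 0)"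
    have "(of_nat (pop v n) :: ennreal) = (\<Sum>\<^sub>\<infinity>i\<in>{0}. of_nat (\<Sum>j=1..immi v i. C1 i j (n - i) v))"
      unfolding pop[rule_format, of n] by (rule infsum_cong_neutral) (auto simp: immi)
    then show "pop v n = C1 0 1 n v" using immi by simp
  qed
  then have "distr P path_space (\<lambda>v n. pop v n) = distr P path_space (\<lambda>v n. C1 0 1 n v)"
  proof (intro distr_cong_AE)
    have "prob_space.indep_vars P (\<lambda>_. path_space) (\<lambda>(i, j) \<omega> n. C1 i j n \<omega>) (UNIV \<times> {1..})"
      using C1 by (simp add: indep_copies_def)
    then have "(case (0, 1) of (i, j) \<Rightarrow> \<lambda>\<omega> n. C1 i j n \<omega>) \<in> measurable P path_space"
      unfolding prob_space.indep_vars_def[OF P] by (rule conjunct1[THEN bspec]) auto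
    then show "(\<lambda>v n. C1 0 1 n v) \<in> measurable P path_space" by simp
  qed (auto intro: pop_m simp: fun_eq_iff)
  also have "\<dots> = distr N path_space (\<lambda>\<omega> n. branching coord n (Z \<omega>))"
    using C1 by (simp add: indep_copies_def)
  finally have single: "distr P path_space (\<lambda>v n. pop v n) = distr N path_space (\<lambda>\<omega> n. branching coord n (Z \<omega>))" .

  have shed_m: "shed \<in> measurable P nat_prod"
    unfolding shed_def[abs_def] P_def by (intro measurable_nat_prodI) simp
  have shed_law: "distr P nat_prod shed = pmf_prod (data_law (child_law \<beta>) \<beta>)"
  proof -
    \<comment> \<open>For \<open>n \<le> 0\<close> the new immigration reads coordinate
      \<open>n - 1 < 0\<close>, where the point mass sits at 0; for \<open>n \<ge> 1\<close> it
      reads a child count of lag index \<open>nat n - 1\<close>.\<close>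
    have eq: "(\<lambda>b. data_law \<delta> \<beta> (shed_index b)) = data_law (child_law \<beta>) \<beta>"
      by (auto simp: fun_eq_iff shed_index_def \<delta>_def child_law_def data_law_def split: sum.split)
    show ?thesis
      unfolding shed_def[abs_def] eq[symmetric] by (rule distr_pmf_prod_reindex[OF id inj_shed_index])
  qed
  have child_mean: "(\<integral>\<^sup>+x. of_nat x \<partial>measure_pmf (child_law \<beta> n)) \<le> ennreal 1" for n
    using beta_le_1 by (auto simp: child_law_def nn_integral_pois beta_nonneg intro!: ennreal_leI)
  obtain C0 where C0: "indep_copies P C0 N (\<lambda>n \<omega>. branching coord n (Z \<omega>))"
    and C0_fam: "family_indep_of P C0 (\<lambda>n v. immi (shed v) n)"
    and C0_AE: "AE v in P. \<forall>n. (of_nat (pop (shed v) n) :: ennreal) =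
      (\<Sum>\<^sub>\<infinity>i\<in>UNIV. of_nat (\<Sum>j=1..immi (shed v) i. C0 i j (n - i) v))"
    and C0_neg: "\<And>i j n v. n < 0 \<Longrightarrow> C0 i j n v = 0"
    using ex_clusters[OF P shed_m shed_law child_mean _ Z Z_law] by auto
  let ?R = "\<lambda>v n. superposition (\<lambda>i. immi (shed v) i) (\<lambda>(i, j) m. C0 i j m v) n"
  have "AE v in P. \<forall>n. pop v n = ?R v n"
    using C0_AE immi_AE reg
  proof (eventually_elim, intro allI)
    fix v n
    assume pop: "\<forall>n. (of_nat (pop (shed v) n) :: ennreal) =
        (\<Sum>\<^sub>\<infinity>i\<in>UNIV. of_nat (\<Sum>j=1..immi (shed v) i. C0 i j (n - i) v))"
      and immi: "\<forall>n. immi v n = (if n = 0 then 1 else 0)" and v: "regular v"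
    \<comment> \<open>Nobody immigrates before time 1 and no cluster precedes its founder, so only
      the times in \<open>{1..n}\<close> contribute.\<close>
    have "(of_nat (pop (shed v) n) :: ennreal) =
        (\<Sum>\<^sub>\<infinity>i\<in>{1..n}. of_nat (\<Sum>j=1..immi (shed v) i. C0 i j (n - i) v))"
      unfolding pop[rule_format, of n]
      by (rule infsum_cong_neutral) (auto simp: shed_simps(1) immi C0_neg)
    then have "(of_nat (pop (shed v) n) :: ennreal) =
        of_nat (\<Sum>i=1..n. \<Sum>j=1..immi (shed v) i. C0 i j (n - i) v)"
      by simp
    then have "pop (shed v) n = (\<Sum>i=1..n. \<Sum>j=1..immi (shed v) i. C0 i j (n - i) v)"
      by (simp only: of_nat_eq_iff)
    then show "pop v n = ?R v n"
      using pop_shed[OF immi[rule_format] v, of n] by simp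
  qed
  then have "distr P path_space (\<lambda>v n. pop v n) = distr P path_space ?R"
    using distr_superposition(1)[OF P C0 C0_fam]
    by (intro distr_cong_AE refl pop_m) (auto simp: fun_eq_iff)
  also have "\<dots> = distr (distr P path_space (\<lambda>v n. immi (shed v) n) \<Otimes>\<^sub>M
        (\<Pi>\<^sub>M p\<in>UNIV \<times> {1..}. distr N path_space (\<lambda>\<omega> n. branching coord n (Z \<omega>))))
      path_space (\<lambda>(h, c) n. superposition h c n)"
    by (rule distr_superposition(2)[OF P C0 C0_fam])
  also have "distr P path_space (\<lambda>v n. immi (shed v) n) = distr K path_space (\<lambda>\<omega> n. H n \<omega>)"
  proof -
    have "distr P path_space (\<lambda>v n. immi (shed v) n) = pmf_prod (\<lambda>n. data_law (child_law \<beta>) \<beta> (Inl n))"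
      unfolding path_space_def by (rule distr_pmf_prod_reindex[OF shed_m shed_law]) simp
    also have "\<dots> = pmf_prod (child_law \<beta>)" by simp
    also have "\<dots> = distr K path_space (\<lambda>\<omega> n. H n \<omega>)"
      unfolding H using distr_generation_1[OF N Z Z_law] by (simp add: path_space_def)
    finally show ?thesis .
  qed
  also have "distr (distr K path_space (\<lambda>\<omega> n. H n \<omega>) \<Otimes>\<^sub>M
        (\<Pi>\<^sub>M p\<in>UNIV \<times> {1..}. distr N path_space (\<lambda>\<omega> n. branching coord n (Z \<omega>))))
      path_space (\<lambda>(h, c) n. superposition h c n)
    = distr K path_space (\<lambda>\<omega> n. superposition (\<lambda>i. H i \<omega>) (\<lambda>(i, j) m. C i j m \<omega>) n)"
    by (rule distr_superposition(2)[OF K copies fam, symmetric])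
  finally show ?thesis using single by simp
qed

end

section \<open>The stationary solution\<close>

lemma measure_cylinder:
  assumes W: "W \<in> measurable M nat_prod" and law: "distr M nat_prod W = pmf_prod \<nu>" and J: "finite J"
  shows "measure M {\<omega>\<in>space M. \<forall>q\<in>J. W \<omega> q \<in> A q} = (\<Prod>q\<in>J. measure (measure_pmf (\<nu> q)) (A q))"
proof -
  interpret P: product_prob_space "\<lambda>q. measure_pmf (\<nu> q)" UNIV
    by unfold_locales
  let ?S = "{v. \<forall>q\<in>J. v q \<in> A q}"
  have S: "?S = prod_emb UNIV (\<lambda>q. measure_pmf (\<nu> q)) J (Pi\<^sub>E J A)"
    by (auto simp: prod_emb_def PiE_iff)
  then have "?S \<in> sets (pmf_prod \<nu>)"
    using J by (auto intro!: sets_PiM_I)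
  then have "measure (pmf_prod \<nu>) ?S = measure M (W -` ?S \<inter> space M)"
    unfolding law[symmetric] using W by (intro measure_distr) auto
  moreover have "measure (pmf_prod \<nu>) ?S = (\<Prod>q\<in>J. measure (measure_pmf (\<nu> q)) (A q))"
    unfolding S using J by (intro P.measure_PiM_emb) auto
  moreover have "W -` ?S \<inter> space M = {\<omega>\<in>space M. \<forall>q\<in>J. W \<omega> q \<in> A q}"
    by auto
  ultimately show ?thesis by simp
qed

definition inar_coords ::
  "(int \<Rightarrow> 'a \<Rightarrow> nat) \<Rightarrow> (int \<Rightarrow> nat \<Rightarrow> nat \<Rightarrow> 'a \<Rightarrow> nat) \<Rightarrow> 'a \<Rightarrow> inar_data" where
  "inar_coords \<epsilon> \<xi> \<omega> b = (case b of Inl n \<Rightarrow> \<epsilon> n \<omega> | Inr (n, k, l) \<Rightarrow> \<xi> n (Suc k) (Suc l) \<omega>)"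

lemma inar_coords_simps [simp]:
  "inar_coords \<epsilon> \<xi> \<omega> (Inl n) = \<epsilon> n \<omega>"
  "inar_coords \<epsilon> \<xi> \<omega> (Inr (n, k, l)) = \<xi> n (Suc k) (Suc l) \<omega>"
  by (simp_all add: inar_coords_def)

text \<open>Independence within \<epsilon>, within \<xi> and between the two merges into a single
  product law: a cylinder splits into an immigration part and an offspring part.\<close>

lemma distr_inar_coords:
  assumes M: "prob_space M" and innov: "inar_innovations M \<alpha> \<epsilon> \<xi>"
  shows "inar_coords \<epsilon> \<xi> \<in> measurable M nat_prod"
    and "distr M nat_prod (inar_coords \<epsilon> \<xi>) = pmf_prod (data_law (\<lambda>_. pois (\<alpha> 0)) (\<lambda>k. \<alpha> (Suc k)))"
proof -
  interpret prob_space M by fact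
  let ?I = "UNIV \<times> {1..} \<times> {1..} :: (int \<times> nat \<times> nat) set"
  let ?f = "\<lambda>(n, k, l). (n, Suc k, Suc l) :: int \<times> nat \<times> nat"
  have \<epsilon>_ind: "indep_vars (\<lambda>_. nat_space) \<epsilon> UNIV"
    and \<epsilon>_law: "\<And>n. distr M nat_space (\<epsilon> n) = measure_pmf (pois (\<alpha> 0))"
    and \<xi>_ind: "indep_vars (\<lambda>_. nat_space) (\<lambda>(n, k, l). \<xi> n k l) ?I"
    and \<xi>_law: "\<And>n k l. k \<ge> 1 \<Longrightarrow> l \<ge> 1 \<Longrightarrow> distr M nat_space (\<xi> n k l) = measure_pmf (pois (\<alpha> k))"
    and ind: "indep_set {(\<lambda>\<omega> n. \<epsilon> n \<omega>) -` A \<inter> space M | A. A \<in> sets path_space}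
      {(\<lambda>\<omega>. \<lambda>(n, k, l)\<in>?I. \<xi> n k l \<omega>) -` B \<inter> space M | B. B \<in> sets (\<Pi>\<^sub>M p\<in>?I. nat_space)}"
    using innov by (auto simp: inar_innovations_def indep_rv_def)
  define \<xi>' where "\<xi>' y = (case ?f y of (n, k, l) \<Rightarrow> \<xi> n k l)" for y
  have \<epsilon>_m: "\<epsilon> n \<in> measurable M nat_space" for n
    using \<epsilon>_ind unfolding indep_vars_def by blast
  have \<xi>'_ind: "indep_vars (\<lambda>_. nat_space) \<xi>' UNIV"
    unfolding \<xi>'_def[abs_def]
    by (rule indep_vars_reindex[OF M \<xi>_ind, where f="?f"]) (auto intro: injI)
  have \<xi>'_m: "\<xi>' y \<in> measurable M nat_space" for y
    using \<xi>'_ind unfolding indep_vars_def by blast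
  have \<epsilon>_D: "distr M nat_prod (\<lambda>\<omega> n. \<epsilon> n \<omega>) = pmf_prod (\<lambda>_. pois (\<alpha> 0))"
    using distr_eq_pmf_prod_iff[of M \<epsilon> "\<lambda>_. pois (\<alpha> 0)", OF M \<epsilon>_m] \<epsilon>_ind \<epsilon>_law by simp
  have \<xi>'_D: "distr M nat_prod (\<lambda>\<omega> y. \<xi>' y \<omega>) = pmf_prod (\<lambda>(n, k, l). pois (\<alpha> (Suc k)))"
  proof -
    have "distr M nat_space (\<xi>' y) = measure_pmf (case y of (n, k, l) \<Rightarrow> pois (\<alpha> (Suc k)))" for y
      using \<xi>_law by (simp add: \<xi>'_def split: prod.split)
    then show ?thesis
      using distr_eq_pmf_prod_iff[of M \<xi>' "\<lambda>(n, k, l). pois (\<alpha> (Suc k))", OF M \<xi>'_m] \<xi>'_ind by simp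
  qed
  have data: "inar_coords \<epsilon> \<xi> \<omega> (Inr y) = \<xi>' y \<omega>" for \<omega> y
    by (cases y) (simp add: \<xi>'_def)
  have V: "(\<lambda>\<omega>. inar_coords \<epsilon> \<xi> \<omega> q) \<in> measurable M nat_space" for q
    using \<epsilon>_m \<xi>'_m by (cases q) (simp_all add: data)
  then show "inar_coords \<epsilon> \<xi> \<in> measurable M nat_prod"
    by (rule measurable_nat_prodI)
  let ?\<nu> = "data_law (\<lambda>_. pois (\<alpha> 0)) (\<lambda>k. \<alpha> (Suc k))"
  have "distr M nat_prod (\<lambda>\<omega> q. inar_coords \<epsilon> \<xi> \<omega> q) = pmf_prod ?\<nu>"
  proof (rule distr_eq_pmf_prodI[OF M V])
    fix J :: "(int + int \<times> nat \<times> nat) set" and A :: "int + int \<times> nat \<times> nat \<Rightarrow> nat set"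
    assume J: "finite J"
    define J1 J2 where "J1 = Inl -` J" and "J2 = Inr -` J"
    have fin: "finite J1" "finite J2"
      using J by (auto simp: J1_def J2_def intro!: finite_vimageI)
    have J_eq: "J = Inl ` J1 \<union> Inr ` J2"
    proof (intro equalityI subsetI)
      fix q assume "q \<in> J"
      then show "q \<in> Inl ` J1 \<union> Inr ` J2"
        by (cases q) (auto simp: J1_def J2_def)
    qed (auto simp: J1_def J2_def)
    have ball: "(\<forall>q\<in>J. P q) \<longleftrightarrow> (\<forall>n\<in>J1. P (Inl n)) \<and> (\<forall>y\<in>J2. P (Inr y))" for P
      unfolding J_eq by blast
    let ?E1 = "{\<omega>\<in>space M. \<forall>n\<in>J1. \<epsilon> n \<omega> \<in> A (Inl n)}"
    let ?E2 = "{\<omega>\<in>space M. \<forall>y\<in>J2. \<xi>' y \<omega> \<in> A (Inr y)}"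
    have "{\<omega>\<in>space M. \<forall>q\<in>J. inar_coords \<epsilon> \<xi> \<omega> q \<in> A q} = ?E1 \<inter> ?E2"
      unfolding ball inar_coords_simps(1) data by blast
    also have "prob \<dots> = prob ?E1 * prob ?E2"
    proof (rule indep_setD[OF ind])
      have "Measurable.pred path_space (\<lambda>h. \<forall>n\<in>J1. h n \<in> A (Inl n))"
        unfolding path_space_def by (intro pred_intros_finite fin) auto
      then have "{h. \<forall>n\<in>J1. h n \<in> A (Inl n)} \<in> sets path_space"
        by (simp add: pred_def path_space_def space_PiM)
      then show "?E1 \<in> {(\<lambda>\<omega> n. \<epsilon> n \<omega>) -` A \<inter> space M | A. A \<in> sets path_space}"
        by (intro CollectI exI[of _ "{h. \<forall>n\<in>J1. h n \<in> A (Inl n)}"]) auto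
      let ?B = "{x\<in>space (\<Pi>\<^sub>M p\<in>?I. nat_space). \<forall>y\<in>J2. x (?f y) \<in> A (Inr y)}"
      have "Measurable.pred (\<Pi>\<^sub>M p\<in>?I. nat_space) (\<lambda>x. x (?f y) \<in> A (Inr y))" for y
      proof (rule measurable_compose[of "\<lambda>x. x (?f y)" _ nat_space])
        show "(\<lambda>x. x (?f y)) \<in> measurable (\<Pi>\<^sub>M p\<in>?I. nat_space) nat_space"
          by (rule measurable_component_singleton) (auto split: prod.split)
      qed simp
      then have "Measurable.pred (\<Pi>\<^sub>M p\<in>?I. nat_space) (\<lambda>x. \<forall>y\<in>J2. x (?f y) \<in> A (Inr y))"
        by (intro pred_intros_finite fin) auto
      then have "?B \<in> sets (\<Pi>\<^sub>M p\<in>?I. nat_space)"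
        by (simp add: pred_def)
      moreover have "?E2 = (\<lambda>\<omega>. \<lambda>(n, k, l)\<in>?I. \<xi> n k l \<omega>) -` ?B \<inter> space M"
        by (auto simp: space_PiM \<xi>'_def split: prod.splits)
      ultimately show "?E2 \<in> {(\<lambda>\<omega>. \<lambda>(n, k, l)\<in>?I. \<xi> n k l \<omega>) -` B \<inter> space M | B. B \<in> sets (\<Pi>\<^sub>M p\<in>?I. nat_space)}"
        by blast
    qed
    also have "prob ?E1 = (\<Prod>n\<in>J1. measure (measure_pmf (pois (\<alpha> 0))) (A (Inl n)))"
      by (rule measure_cylinder[OF _ \<epsilon>_D fin(1)]) (intro measurable_nat_prodI \<epsilon>_m)
    also have "prob ?E2 = (\<Prod>y\<in>J2. measure (measure_pmf (case y of (n, k, l) \<Rightarrow> pois (\<alpha> (Suc k)))) (A (Inr y)))"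
      by (rule measure_cylinder[OF _ \<xi>'_D fin(2)]) (intro measurable_nat_prodI \<xi>'_m)
    also have "(\<Prod>n\<in>J1. measure (measure_pmf (pois (\<alpha> 0))) (A (Inl n))) *
        (\<Prod>y\<in>J2. measure (measure_pmf (case y of (n, k, l) \<Rightarrow> pois (\<alpha> (Suc k)))) (A (Inr y)))
      = (\<Prod>q\<in>J. measure (measure_pmf (?\<nu> q)) (A q))"
      unfolding J_eq using fin
      by (subst prod.union_disjoint) (auto simp: prod.reindex data_law_def)
    finally show "prob {\<omega>\<in>space M. \<forall>q\<in>J. inar_coords \<epsilon> \<xi> \<omega> q \<in> A q} = (\<Prod>q\<in>J. measure (measure_pmf (?\<nu> q)) (A q))" .
  qed
  then show "distr M nat_prod (inar_coords \<epsilon> \<xi>) = pmf_prod ?\<nu>" .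
qed

section \<open>Offspring arrays and coefficients with indices from 0\<close>

definition offspring_coords ::
  "(int \<Rightarrow> nat \<Rightarrow> nat \<Rightarrow> nat \<Rightarrow> 'b \<Rightarrow> nat) \<Rightarrow> 'b \<Rightarrow> offspring_data" where
  "offspring_coords \<zeta> \<omega> = (\<lambda>(n, k, g, m). \<zeta> n (Suc k) (Suc g) (Suc m) \<omega>)"

lemma distr_offspring_coords:
  assumes N: "prob_space N" and off: "offspring_array N \<alpha> \<zeta>"
  shows "offspring_coords \<zeta> \<in> measurable N nat_prod"
    and "distr N nat_prod (offspring_coords \<zeta>) = pmf_prod (offspring_law (\<lambda>k. \<alpha> (Suc k)))"
proof -
  interpret prob_space N by fact
  let ?I = "UNIV \<times> {1..} \<times> {1..} \<times> {1..} :: (int \<times> nat \<times> nat \<times> nat) set"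
  let ?f = "\<lambda>(n, k, g, m). (n, Suc k, Suc g, Suc m) :: int \<times> nat \<times> nat \<times> nat"
  have ind: "indep_vars (\<lambda>_. nat_space) (\<lambda>(n, k, g, m). \<zeta> n k g m) ?I"
    and law: "\<And>n k g m. k \<ge> 1 \<Longrightarrow> g \<ge> 1 \<Longrightarrow> m \<ge> 1 \<Longrightarrow> distr N nat_space (\<zeta> n k g m) = measure_pmf (pois (\<alpha> k))"
    using off by (auto simp: offspring_array_def)
  define \<zeta>' where "\<zeta>' y = (case ?f y of (n, k, g, m) \<Rightarrow> \<zeta> n k g m)" for y
  have \<zeta>'_ind: "indep_vars (\<lambda>_. nat_space) \<zeta>' UNIV"
    unfolding \<zeta>'_def[abs_def]
    by (rule indep_vars_reindex[OF N ind, where f="?f"]) (auto intro: injI)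
  have \<zeta>'_m: "\<zeta>' y \<in> measurable N nat_space" for y
    using \<zeta>'_ind unfolding indep_vars_def by blast
  have data: "offspring_coords \<zeta> = (\<lambda>\<omega> y. \<zeta>' y \<omega>)"
    by (auto simp: fun_eq_iff offspring_coords_def \<zeta>'_def)
  show "offspring_coords \<zeta> \<in> measurable N nat_prod"
    unfolding data by (intro measurable_nat_prodI \<zeta>'_m)
  have "distr N nat_space (\<zeta>' y) = measure_pmf (offspring_law (\<lambda>k. \<alpha> (Suc k)) y)" for y
    using law by (simp add: \<zeta>'_def offspring_law_def split: prod.split)
  then show "distr N nat_prod (offspring_coords \<zeta>) = pmf_prod (offspring_law (\<lambda>k. \<alpha> (Suc k)))"
    unfolding data
    using distr_eq_pmf_prod_iff[of N \<zeta>' "offspring_law (\<lambda>k. \<alpha> (Suc k))", OF N \<zeta>'_m] \<zeta>'_ind by simp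
qed

lemma generation_offspring_coords: "generation \<zeta> g n \<omega> = generation coord g n (offspring_coords \<zeta> \<omega>)"
proof (induction g arbitrary: n)
  case (Suc g)
  have "generation \<zeta> (Suc g) n \<omega> =
      (\<Sum>k<nat n. \<Sum>m<generation \<zeta> g (n - 1 - int k) \<omega>. \<zeta> n (Suc k) (Suc g) (Suc m) \<omega>)"
    by (simp add: sum.atLeast1_atMost_eq algebra_simps)
  also have "\<dots> = generation coord (Suc g) n (offspring_coords \<zeta> \<omega>)"
    unfolding generation_coord_Suc Suc.IH by (simp add: offspring_coords_def)
  finally show ?case .
qed simp

lemma branching_offspring_coords: "branching \<zeta> n \<omega> = branching coord n (offspring_coords \<zeta> \<omega>)"
  by (simp only: branching_eq generation_offspring_coords[of \<zeta>])

lemma infsum_from_1: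
  fixes f :: "nat \<Rightarrow> 'a::{t2_space, topological_comm_monoid_add}"
  assumes "f summable_on {1..}"
  shows "(\<lambda>k. f (Suc k)) sums (\<Sum>\<^sub>\<infinity>k\<in>{1..}. f k)"
proof -
  have eq: "{1..} = range Suc"
    by (metis One_nat_def atLeast_Suc_greaterThan greaterThan_0)
  have "(f has_sum (\<Sum>\<^sub>\<infinity>k\<in>{1..}. f k)) (range Suc)"
    using has_sum_infsum[OF assms] unfolding eq .
  then have "(f \<circ> Suc has_sum (\<Sum>\<^sub>\<infinity>k\<in>{1..}. f k)) UNIV"
    by (rule has_sum_reindex[THEN iffD1, OF inj_Suc])
  then have "((\<lambda>k. f (Suc k)) has_sum (\<Sum>\<^sub>\<infinity>k\<in>{1..}. f k)) UNIV"
    unfolding comp_def .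
  then show ?thesis by (rule has_sum_imp_sums)
qed

lemma subcritical_shift:
  assumes "\<And>k. 0 \<le> \<alpha> k" "\<alpha> summable_on {1..}" "(\<Sum>\<^sub>\<infinity>k\<in>{1..}. \<alpha> k) < (1 :: real)"
  shows "subcritical (\<lambda>k. \<alpha> (Suc k))"
  using infsum_from_1[OF assms(2)] assms(1,3)
  by unfold_locales (auto simp: sums_iff)

text \<open>The recursion commutes with time shifts; together with the shift invariance of the law
  of the data this gives stationarity.\<close>

lemma approx_shift:
  "approx r (\<lambda>b. v (case b of Inl n \<Rightarrow> Inl (n + h) | Inr (n, y) \<Rightarrow> Inr (n + h, y))) n = approx r v (n + h)"
proof (induction r arbitrary: n)
  case (Suc r)
  have "n - 1 - int k + h = n + h - 1 - int k" for k by simp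
  then show ?case by (simp only: approx.simps Suc.IH sum.case prod.case)
qed simp

lemma pop_shift:
  "pop (\<lambda>b. v (case b of Inl n \<Rightarrow> Inl (n + h) | Inr (n, y) \<Rightarrow> Inr (n + h, y))) = (\<lambda>n. pop v (n + h))"
  by (simp add: fun_eq_iff pop_def tot_def approx_shift)

text \<open>Uniqueness in \<open>inar_sequence\<close> compares \<open>X\<close> with solutions
  only, so every clause must be checked for \<open>pop\<close>. Independence of the innovations at
  \<open>n\<close> from the past holds because the population at \<open>m < n\<close> reads data up
  to time \<open>m\<close> only.\<close>

lemma inar_solution_pop:
  assumes M: "prob_space M" and innov: "inar_innovations M \<alpha> \<epsilon> \<xi>"
    and \<alpha>: "0 \<le> \<alpha> 0" and sub: "subcritical (\<lambda>k. \<alpha> (Suc k))"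
  shows "inar_solution M \<epsilon> \<xi> (\<lambda>n \<omega>. pop (inar_coords \<epsilon> \<xi> \<omega>) n)"
proof -
  interpret prob_space M by fact
  let ?V = "inar_coords \<epsilon> \<xi>"
  let ?\<nu> = "data_law (\<lambda>_. pois (\<alpha> 0)) (\<lambda>k. \<alpha> (Suc k))"
  note V = distr_inar_coords(1)[OF M innov] and V_law = distr_inar_coords(2)[OF M innov]
  have pop_path: "(\<lambda>v n. pop v n) \<in> measurable nat_prod path_space"
    unfolding path_space_def by (intro measurable_nat_prodI measurable_pop)
  have meas: "(\<lambda>\<omega>. pop (?V \<omega>) n) \<in> measurable M nat_space" for n
    by (rule measurable_compose[OF V measurable_pop])
  have stat: "distr M path_space (\<lambda>\<omega> n. pop (?V \<omega>) (n + h)) = distr M path_space (\<lambda>\<omega> n. pop (?V \<omega>) n)" for h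
  proof -
    define s :: "int + int \<times> nat \<times> nat \<Rightarrow> int + int \<times> nat \<times> nat"
      where "s b = (case b of Inl n \<Rightarrow> Inl (n + h) | Inr (n, y) \<Rightarrow> Inr (n + h, y))" for b
    have "inj s" by (rule injI) (auto simp: s_def split: sum.splits prod.splits)
    then have "distr M nat_prod (\<lambda>\<omega> b. ?V \<omega> (s b)) = pmf_prod (\<lambda>b. ?\<nu> (s b))"
      by (rule distr_pmf_prod_reindex[OF V V_law])
    also have "(\<lambda>b. ?\<nu> (s b)) = ?\<nu>"
      by (auto simp: fun_eq_iff s_def data_law_def split: sum.splits)
    finally have D: "distr M nat_prod (\<lambda>\<omega> b. ?V \<omega> (s b)) = distr M nat_prod ?V"
      by (simp add: V_law)
    have Vs: "(\<lambda>\<omega> b. ?V \<omega> (s b)) \<in> measurable M nat_prod"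
      by (intro measurable_nat_prodI measurable_compose[OF V measurable_from_nat_prod])
    have "distr M path_space (\<lambda>\<omega> n. pop (?V \<omega>) (n + h))
        = distr (distr M nat_prod (\<lambda>\<omega> b. ?V \<omega> (s b))) path_space (\<lambda>v n. pop v n)"
      unfolding distr_distr[OF pop_path Vs] by (simp add: comp_def s_def pop_shift)
    also have "\<dots> = distr M path_space (\<lambda>\<omega> n. pop (?V \<omega>) n)"
      unfolding D distr_distr[OF pop_path V] by (simp add: comp_def)
    finally show ?thesis .
  qed
  have mean: "(\<integral>\<^sup>+x. of_nat x \<partial>measure_pmf (pois (\<alpha> 0))) \<le> ennreal (\<alpha> 0)"
    by (simp add: nn_integral_pois \<alpha>)
  have rec: "AE \<omega> in M. (of_nat (pop (?V \<omega>) n) :: ennreal) = of_nat (\<epsilon> n \<omega>) +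
      (\<Sum>\<^sub>\<infinity>k\<in>{1..}. of_nat (\<Sum>l=1..pop (?V \<omega>) (n - int k). \<xi> n k l \<omega>))" for n
    using AE_regular_distr[OF sub V V_law mean \<alpha>]
  proof (rule eventually_mono)
    fix \<omega> assume reg: "regular (?V \<omega>)"
    let ?f = "\<lambda>k. of_nat (\<Sum>l=1..pop (?V \<omega>) (n - int k). \<xi> n k l \<omega>) :: ennreal"
    have "(\<Sum>\<^sub>\<infinity>k\<in>{1..}. ?f k) = (\<Sum>k. ?f (Suc k))"
      by (rule sums_unique[OF infsum_from_1[OF nonneg_summable_on_complete]]) simp
    also have "\<dots> = (\<Sum>k. of_nat (\<Sum>l<pop (?V \<omega>) (n - 1 - int k). kids (?V \<omega>) n k l))"
      by (simp add: sum.atLeast1_atMost_eq algebra_simps)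
    finally show "(of_nat (pop (?V \<omega>) n) :: ennreal) = of_nat (\<epsilon> n \<omega>) + (\<Sum>\<^sub>\<infinity>k\<in>{1..}. ?f k)"
      using pop_eq[OF reg, of n] by simp
  qed
  have ind: "indep_rv M (nat_space \<Otimes>\<^sub>M (\<Pi>\<^sub>M p\<in>{1..} \<times> {1..}. nat_space))
      (\<lambda>\<omega>. (\<epsilon> n \<omega>, \<lambda>(k, l)\<in>{1..} \<times> {1..}. \<xi> n k l \<omega>))
      (\<Pi>\<^sub>M m\<in>{..<n}. nat_space) (\<lambda>\<omega>. \<lambda>m\<in>{..<n}. pop (?V \<omega>) m)" for n
  proof -
    let ?A = "{b. time b = n}" and ?B = "{b. time b < n}"
    have Vq: "(\<lambda>\<omega>. ?V \<omega> q) \<in> measurable M nat_space" for q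
      using measurable_compose[OF V measurable_from_nat_prod] .
    have "indep_vars (\<lambda>_. nat_space) (\<lambda>q \<omega>. ?V \<omega> q) UNIV"
      using distr_eq_pmf_prod_iff[of M "\<lambda>q \<omega>. ?V \<omega> q" ?\<nu>, OF M Vq] V_law by simp
    then have iv: "indep_var (PiM ?A (\<lambda>_. nat_space)) (\<lambda>\<omega>. restrict (?V \<omega>) ?A)
        (PiM ?B (\<lambda>_. nat_space)) (\<lambda>\<omega>. restrict (?V \<omega>) ?B)"
      by (rule indep_var_restrict) auto
    define f :: "inar_data \<Rightarrow> nat \<times> (nat \<times> nat \<Rightarrow> nat)"
      where "f w = (w (Inl n), \<lambda>(k, l)\<in>{1..} \<times> {1..}. w (Inr (n, k - 1, l - 1)))" for w
    \<comment> \<open>\<open>pop\<close> expects data at all times. Coordinates from time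
      \<open>n\<close> on are filled with 0, which does not affect the populations before
      \<open>n\<close>.\<close>
    define ext :: "inar_data \<Rightarrow> inar_data" where "ext w b = (if time b < n then w b else 0)" for w b
    define g :: "inar_data \<Rightarrow> int \<Rightarrow> nat" where "g w = (\<lambda>m\<in>{..<n}. pop (ext w) m)" for w
    have f: "f \<in> measurable (PiM ?A (\<lambda>_. nat_space)) (nat_space \<Otimes>\<^sub>M (\<Pi>\<^sub>M p\<in>{1..} \<times> {1..}. nat_space))"
      unfolding f_def
      by (intro measurable_Pair measurable_restrict) (auto intro!: measurable_component_singleton)
    have ext: "ext \<in> measurable (PiM ?B (\<lambda>_. nat_space)) nat_prod"
    proof (rule measurable_nat_prodI)
      show "(\<lambda>w. ext w b) \<in> measurable (PiM ?B (\<lambda>_. nat_space)) nat_space" for b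
        by (cases "time b < n") (simp_all add: ext_def measurable_component_singleton)
    qed
    have g: "g \<in> measurable (PiM ?B (\<lambda>_. nat_space)) (\<Pi>\<^sub>M m\<in>{..<n}. nat_space)"
      unfolding g_def by (intro measurable_restrict measurable_compose[OF ext measurable_pop])
    have "pop (ext (restrict (?V \<omega>) ?B)) m = pop (?V \<omega>) m" if "m < n" for m \<omega>
      using that by (intro pop_cong) (auto simp: agree_def ext_def)
    then have "g (restrict (?V \<omega>) ?B) = (\<lambda>m\<in>{..<n}. pop (?V \<omega>) m)" for \<omega>
      by (auto simp: g_def fun_eq_iff)
    moreover have "f (restrict (?V \<omega>) ?A) = (\<epsilon> n \<omega>, \<lambda>(k, l)\<in>{1..} \<times> {1..}. \<xi> n k l \<omega>)" for \<omega>
      by (auto simp: f_def fun_eq_iff)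
    ultimately show ?thesis
      using indep_rv_compose[OF M iv f g] by simp
  qed
  show ?thesis
    unfolding inar_solution_def using meas stat rec ind by blast
qed

theorem proposition3:
  fixes \<alpha> :: "nat \<Rightarrow> real"
    and M :: "'a measure"
    and \<epsilon> :: "int \<Rightarrow> 'a \<Rightarrow> nat"
    and \<xi> :: "int \<Rightarrow> nat \<Rightarrow> nat \<Rightarrow> 'a \<Rightarrow> nat"
    and X :: "int \<Rightarrow> 'a \<Rightarrow> nat"
    and N :: "'b measure"
    and \<zeta> :: "int \<Rightarrow> nat \<Rightarrow> nat \<Rightarrow> nat \<Rightarrow> 'b \<Rightarrow> nat"
  assumes "\<And>k. 0 \<le> \<alpha> k"
    and "\<alpha> summable_on {1..}"
    and "(\<Sum>\<^sub>\<infinity>k\<in>{1..}. \<alpha> k) < 1"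
    and "prob_space M"
    and "inar_innovations M \<alpha> \<epsilon> \<xi>"
    and "inar_sequence M \<epsilon> \<xi> X"
    and "prob_space N"
    and "offspring_array N \<alpha> \<zeta>"
  shows "(\<exists>C. indep_copies M C N (branching \<zeta>) \<and>
              family_indep_of M C \<epsilon> \<and>
              (\<forall>n. AE \<omega> in M. (of_nat (X n \<omega>) :: ennreal) =
                 (\<Sum>\<^sub>\<infinity>i\<in>UNIV. of_nat (\<Sum>j=1..\<epsilon> i \<omega>. C i j (n - i) \<omega>)))) \<and>
         (\<forall>(K :: 'c measure) H C.
            prob_space K \<longrightarrow>
            distr K path_space (\<lambda>\<omega> n. H n \<omega>) = distr N path_space (\<lambda>\<omega> n. generation \<zeta> 1 n \<omega>) \<longrightarrow>
            indep_copies K C N (branching \<zeta>) \<longrightarrow>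
            family_indep_of K C H \<longrightarrow>
            distr N path_space (\<lambda>\<omega> n. branching \<zeta> n \<omega>) =
            distr K path_space (\<lambda>\<omega> n.
              (if n = 0 then 1 else 0) + (\<Sum>i=1..n. \<Sum>j=1..H i \<omega>. C i j (n - i) \<omega>)))"
proof -
  interpret subcritical "\<lambda>k. \<alpha> (Suc k)"
    by (rule subcritical_shift[OF assms(1-3)])
  note V = distr_inar_coords[OF assms(4,5)] and Z = distr_offspring_coords[OF assms(7,8)]
  have mean: "(\<integral>\<^sup>+x. of_nat x \<partial>measure_pmf (pois (\<alpha> 0))) \<le> ennreal (\<alpha> 0)"
    by (simp add: nn_integral_pois assms(1))
  have branching: "branching \<zeta> = (\<lambda>n \<omega>. branching coord n (offspring_coords \<zeta> \<omega>))"
    by (intro ext) (rule branching_offspring_coords)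
  have "inar_solution M \<epsilon> \<xi> (\<lambda>n \<omega>. pop (inar_coords \<epsilon> \<xi> \<omega>) n)"
    by (rule inar_solution_pop[OF assms(4,5) assms(1) subcritical_axioms])
  then have X: "AE \<omega> in M. \<forall>n. pop (inar_coords \<epsilon> \<xi> \<omega>) n = X n \<omega>"
    using assms(6) by (simp add: inar_sequence_def)
  obtain C where C: "indep_copies M C N (branching \<zeta>)" "family_indep_of M C \<epsilon>"
    and C_AE: "AE \<omega> in M. \<forall>n. (of_nat (pop (inar_coords \<epsilon> \<xi> \<omega>) n) :: ennreal) =
      (\<Sum>\<^sub>\<infinity>i\<in>UNIV. of_nat (\<Sum>j=1..\<epsilon> i \<omega>. C i j (n - i) \<omega>))"
    using ex_clusters[OF assms(4) V mean assms(1) Z] unfolding branching inar_coords_simps by blast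
  have "AE \<omega> in M. (of_nat (X n \<omega>) :: ennreal) =
      (\<Sum>\<^sub>\<infinity>i\<in>UNIV. of_nat (\<Sum>j=1..\<epsilon> i \<omega>. C i j (n - i) \<omega>))" for n
    using X C_AE by eventually_elim metis
  with C have part1: "\<exists>C. indep_copies M C N (branching \<zeta>) \<and> family_indep_of M C \<epsilon> \<and>
      (\<forall>n. AE \<omega> in M. (of_nat (X n \<omega>) :: ennreal) =
        (\<Sum>\<^sub>\<infinity>i\<in>UNIV. of_nat (\<Sum>j=1..\<epsilon> i \<omega>. C i j (n - i) \<omega>)))"
    by blast
  have part2: "distr N path_space (\<lambda>\<omega> n. branching \<zeta> n \<omega>) =
      distr K path_space (\<lambda>\<omega> n. (if n = 0 then 1 else 0) + (\<Sum>i=1..n. \<Sum>j=1..H i \<omega>. C i j (n - i) \<omega>))"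
    if "prob_space K"
      "distr K path_space (\<lambda>\<omega> n. H n \<omega>) = distr N path_space (\<lambda>\<omega> n. generation \<zeta> 1 n \<omega>)"
      "indep_copies K C N (branching \<zeta>)" "family_indep_of K C H"
    for K :: "'c measure" and H C
    using distr_branching_eq_superposition[OF assms(7) Z that(1) _ _ that(4)] that(2,3)
    unfolding branching generation_offspring_coords[of \<zeta>] by simp
  show ?thesis using part1 part2 by blast
qed

end
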